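(* Let $n\ge1$ and $\mathbb{F}=\mathbb{R}$ or $\mathbb{C}$. Then the map that forgets the flat connection on path-connected components of representation spaces $$\pi_0(\mathrm{Rep}(\mathbb{Z}^k,\widetilde{\mathrm{H}}_{2n+1}(\mathbb{F})))\to H^2(\mathbb{Z}^k;A)$$ is injective for every $k\ge 2$, and surjective if and only if $\lfloor k/2\rfloor\le n$.
   Context: $\mathrm{H}_{2n+1}(\mathbb{F})$ is the group of $(n+2)\times(n+2)$ upper unitriangular matrices of block form $\begin{pmatrix}1&a&z\\0&I_n&b\\0&0&1\end{pmatrix}$ with $a\in\mathrm{Mat}_{1\times n}(\mathbb{F})$, $b\in\mathrm{Mat}_{n\times1}(\mathbb{F})$, $z\in\mathbb{F}$. $A$ is the central subgroup with $a=0,b=0$ and $z\in\mathbb{Z}$ (if $\mathbb{F}=\mathbb{R}$) or $z\in\mathbb{Z}[i]\cong\mathbb{Z}^2$ (if $\mathbb{F}=\mathbb{C}$). $\widetilde{\mathrm{H}}_{2n+1}(\mathbb{F})=\mathrm{H}_{2n+1}(\mathbb{F})/A$, with universal cover $\mathrm{H}_{2n+1}(\mathbb{F})$. $\mathrm{Hom}(\mathbb{Z}^k,G)$ is the space of homomorphisms, topologized as the subspace of commuting tuples in $G^k$, and $\mathrm{Rep}(\mathbb{Z}^k,G)=\mathrm{Hom}(\mathbb{Z}^k,G)/G$ is its orbit space under conjugation, with the quotient topology. $H^2(\mathbb{Z}^k;A)\cong\mathrm{Ant}_k(A)$, antisymmetric $k\times k$ matrices with entries in $A$. The map that forgets the flat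 connection sends the class of $\rho$ to the matrix $([\tilde g_i,\tilde g_j])_{i,j}$, where $\tilde g_i\in \mathrm{H}_{2n+1}(\mathbb{F})$ is any lift of $\rho(e_i)$, $e_1,\dots,e_k$ is the canonical basis of $\mathbb{Z}^k$, and $[x,y]=x^{-1}y^{-1}xy$; it is locally constant and conjugation invariant. *)

theory Defs
  imports
    "HOL-Analysis.Analysis"
    "HOL-Algebra.Coset"
    "HOL-Algebra.Group_Action"
    "HOL-Algebra.Elementary_Groups"
    "HOL-Algebra.Product_Groups"
begin

section \<open>Quotient topologies\<close>

definition quotient_topology :: "'a topology \<Rightarrow> ('a \<Rightarrow> 'b) \<Rightarrow> 'b topology" where
  "quotient_topology X f =
     topology (\<lambda>U. U \<subseteq> f ` topspace X \<and> openin X {x \<in> topspace X. f x \<in> U})"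

lemma openin_quotient_topology:
  "openin (quotient_topology X f) U \<longleftrightarrow>
     U \<subseteq> f ` topspace X \<and> openin X {x \<in> topspace X. f x \<in> U}"
proof -
  have "istopology (\<lambda>U. U \<subseteq> f ` topspace X \<and> openin X {x \<in> topspace X. f x \<in> U})"
    unfolding istopology_def
  proof (intro conjI allI impI)
    fix S T
    assume "S \<subseteq> f ` topspace X \<and> openin X {x \<in> topspace X. f x \<in> S}"
      and "T \<subseteq> f ` topspace X \<and> openin X {x \<in> topspace X. f x \<in> T}"
    moreover have "{x \<in> topspace X. f x \<in> S \<inter> T} =
        {x \<in> topspace X. f x \<in> S} \<inter> {x \<in> topspace X. f x \<in> T}"
      by blast
    ultimately show "S \<inter> T \<subseteq> f ` topspace X"
      and "openin X {x \<in> topspace X. f x \<in> S \<inter> T}"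
      by auto
  next
    fix K
    assume K: "\<forall>S\<in>K. S \<subseteq> f ` topspace X \<and> openin X {x \<in> topspace X. f x \<in> S}"
    then show "\<Union>K \<subseteq> f ` topspace X"
      by blast
    have "{x \<in> topspace X. f x \<in> \<Union>K} = (\<Union>S\<in>K. {x \<in> topspace X. f x \<in> S})"
      by blast
    with K show "openin X {x \<in> topspace X. f x \<in> \<Union>K}"
      by auto
  qed
  then show ?thesis
    unfolding quotient_topology_def by (simp add: topology_inverse')
qed

lemma topspace_quotient_topology: "topspace (quotient_topology X f) = f ` topspace X"
proof -
  have "{x \<in> topspace X. f x \<in> f ` topspace X} = topspace X"
    by blast
  then have "openin (quotient_topology X f) (f ` topspace X)"
    by (simp add: openin_quotient_topology)
  then have "f ` topspace X \<subseteq> topspace (quotient_topology X f)"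
    by (rule openin_subset)
  moreover have "topspace (quotient_topology X f) \<subseteq> f ` topspace X"
    using openin_topspace[of "quotient_topology X f"]
    unfolding openin_quotient_topology by (rule conjunct1)
  ultimately show ?thesis
    by (rule subset_antisym[rotated])
qed

lemma quotient_map_quotient_topology: "quotient_map X (quotient_topology X f) f"
  by (auto simp: quotient_map_def topspace_quotient_topology openin_quotient_topology)


section \<open>Spaces of homomorphisms and of representations\<close>

abbreviation Zpow :: "nat \<Rightarrow> (nat \<Rightarrow> int) monoid" where
  "Zpow k \<equiv> product_group {..<k} (\<lambda>_. integer_group)"

definition unit_tuple :: "nat \<Rightarrow> nat \<Rightarrow> nat \<Rightarrow> int" where
  "unit_tuple k i = (\<lambda>j\<in>{..<k}. if j = i then 1 else 0)"

text \<open>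
  Elements of \<^const>\<open>hom\<close> are unconstrained outside the carrier of the source;
  extensionality makes equality of homomorphisms the equality of functions.
\<close>

definition Hom_set :: "nat \<Rightarrow> 'g monoid \<Rightarrow> ((nat \<Rightarrow> int) \<Rightarrow> 'g) set" where
  "Hom_set k G = hom (Zpow k) G \<inter> extensional (carrier (Zpow k))"

text \<open>
  The pullback along evaluation at the basis, which is injective on \<open>Hom_set k G\<close>, is the
  subspace topology of the set of commuting \<open>k\<close>-tuples in \<open>G\<^sup>k\<close>.
\<close>

definition Hom_space :: "nat \<Rightarrow> 'g monoid \<Rightarrow> 'g topology \<Rightarrow> ((nat \<Rightarrow> int) \<Rightarrow> 'g) topology" where
  "Hom_space k G X =
     pullback_topology (Hom_set k G) (\<lambda>\<rho>. \<lambda>i\<in>{..<k}. \<rho> (unit_tuple k i))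
       (product_topology (\<lambda>_. X) {..<k})"

definition conj_action ::
  "nat \<Rightarrow> 'g monoid \<Rightarrow> 'g \<Rightarrow> ((nat \<Rightarrow> int) \<Rightarrow> 'g) \<Rightarrow> ((nat \<Rightarrow> int) \<Rightarrow> 'g)" where
  "conj_action k G g \<rho> =
     (\<lambda>v\<in>carrier (Zpow k). g \<otimes>\<^bsub>G\<^esub> \<rho> v \<otimes>\<^bsub>G\<^esub> inv\<^bsub>G\<^esub> g)"

definition rep_class :: "nat \<Rightarrow> 'g monoid \<Rightarrow> ((nat \<Rightarrow> int) \<Rightarrow> 'g) \<Rightarrow> ((nat \<Rightarrow> int) \<Rightarrow> 'g) set" where
  "rep_class k G \<rho> = orbit G (conj_action k G) \<rho>"

definition Rep_space ::
  "nat \<Rightarrow> 'g monoid \<Rightarrow> 'g topology \<Rightarrow> ((nat \<Rightarrow> int) \<Rightarrow> 'g) set topology" where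
  "Rep_space k G X = quotient_topology (Hom_space k G X) (rep_class k G)"


section \<open>The map forgetting the flat connection\<close>

definition group_commutator :: "'g monoid \<Rightarrow> 'g \<Rightarrow> 'g \<Rightarrow> 'g" where
  "group_commutator H x y = inv\<^bsub>H\<^esub> x \<otimes>\<^bsub>H\<^esub> inv\<^bsub>H\<^esub> y \<otimes>\<^bsub>H\<^esub> x \<otimes>\<^bsub>H\<^esub> y"

definition lift :: "'g monoid \<Rightarrow> 'g set \<Rightarrow> 'g set \<Rightarrow> 'g" where
  "lift H A c = (SOME x. x \<in> carrier H \<and> A #>\<^bsub>H\<^esub> x = c)"

definition commutator_matrix ::
  "nat \<Rightarrow> 'g monoid \<Rightarrow> 'g set \<Rightarrow> ((nat \<Rightarrow> int) \<Rightarrow> 'g set) \<Rightarrow> (nat \<times> nat \<Rightarrow> 'g)" where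
  "commutator_matrix k H A \<rho> =
     (\<lambda>(i, j)\<in>{..<k} \<times> {..<k}.
        group_commutator H (lift H A (\<rho> (unit_tuple k i))) (lift H A (\<rho> (unit_tuple k j))))"

text \<open>
  \<open>C\<close> is a path component of the representation space of \<open>H Mod A\<close>. The commutator matrix is
  conjugation invariant and locally constant, so it has a single value on \<open>C\<close>.
\<close>

definition forget_flat ::
  "nat \<Rightarrow> 'g monoid \<Rightarrow> 'g set \<Rightarrow> ((nat \<Rightarrow> int) \<Rightarrow> 'g set) set set \<Rightarrow> (nat \<times> nat \<Rightarrow> 'g)" where
  "forget_flat k H A C =
     (THE M. \<forall>\<rho>\<in>Hom_set k (H Mod A).
        rep_class k (H Mod A) \<rho> \<in> C \<longrightarrow> commutator_matrix k H A \<rho> = M)"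

text \<open>
  Antisymmetric \<open>k \<times> k\<close> matrices over an abelian group, written multiplicatively; they stand
  for the second cohomology of \<open>\<int>\<^sup>k\<close> with coefficients in \<open>A\<close>. The diagonal is trivial as
  soon as \<open>A\<close> has no \<open>2\<close>-torsion.
\<close>

definition Ant :: "nat \<Rightarrow> 'g monoid \<Rightarrow> (nat \<times> nat \<Rightarrow> 'g) set" where
  "Ant k A =
     {M \<in> ({..<k} \<times> {..<k}) \<rightarrow>\<^sub>E carrier A. \<forall>i<k. \<forall>j<k. M (j, i) = inv\<^bsub>A\<^esub> (M (i, j))}"


section \<open>Heisenberg groups\<close>

datatype 'n block_index = First | Mid 'n | Last

instance block_index :: (finite) finite
proof
  have "UNIV = {First, Last} \<union> range (Mid :: 'a \<Rightarrow> 'a block_index)"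
  proof (intro equalityI subsetI)
    fix x :: "'a block_index"
    show "x \<in> {First, Last} \<union> range Mid"
      by (cases x) simp_all
  qed simp
  moreover have "finite ({First, Last} \<union> range (Mid :: 'a \<Rightarrow> 'a block_index))"
    by simp
  ultimately show "finite (UNIV :: 'a block_index set)"
    by (rule ssubst)
qed

text \<open>The \<open>(n + 2) \<times> (n + 2)\<close> matrices, with \<open>n = CARD('n)\<close>.\<close>

type_synonym ('f, 'n) block_matrix = "'f ^ 'n block_index ^ 'n block_index"

fun heisenberg_entry ::
  "('f::zero_neq_one) ^ 'n \<Rightarrow> 'f ^ 'n \<Rightarrow> 'f \<Rightarrow> 'n block_index \<Rightarrow> 'n block_index \<Rightarrow> 'f" where
  "heisenberg_entry a b z First First = 1"
| "heisenberg_entry a b z First (Mid j) = a $ j"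
| "heisenberg_entry a b z First Last = z"
| "heisenberg_entry a b z (Mid i) First = 0"
| "heisenberg_entry a b z (Mid i) (Mid j) = (if i = j then 1 else 0)"
| "heisenberg_entry a b z (Mid i) Last = b $ i"
| "heisenberg_entry a b z Last First = 0"
| "heisenberg_entry a b z Last (Mid j) = 0"
| "heisenberg_entry a b z Last Last = 1"

definition heisenberg_matrix ::
  "('f::zero_neq_one) ^ 'n \<Rightarrow> 'f ^ 'n \<Rightarrow> 'f \<Rightarrow> ('f, 'n::finite) block_matrix" where
  "heisenberg_matrix a b z = (\<chi> r c. heisenberg_entry a b z r c)"

definition heisenberg_group :: "('f::real_normed_field, 'n::finite) block_matrix monoid" where
  "heisenberg_group =
     \<lparr>carrier = {heisenberg_matrix a b z | a b z. True}, monoid.mult = (**), one = mat 1\<rparr>"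

definition heisenberg_topology :: "('f::real_normed_field, 'n::finite) block_matrix topology" where
  "heisenberg_topology = top_of_set (carrier heisenberg_group)"

text \<open>\<open>L\<close> is the ring of integers: \<open>\<int>\<close> in \<open>\<real>\<close>, or the Gaussian integers in \<open>\<complex>\<close>.\<close>

definition central_lattice ::
  "'f set \<Rightarrow> ('f::real_normed_field, 'n::finite) block_matrix set" where
  "central_lattice L = {heisenberg_matrix 0 0 z | z. z \<in> L}"

definition gaussian_integers :: "complex set" where
  "gaussian_integers = {z. Re z \<in> \<int> \<and> Im z \<in> \<int>}"

definition reduced_heisenberg_group ::
  "'f set \<Rightarrow> ('f::real_normed_field, 'n::finite) block_matrix set monoid" where
  "reduced_heisenberg_group L = heisenberg_group Mod central_lattice L"

definition reduced_heisenberg_topology ::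
  "'f set \<Rightarrow> ('f::real_normed_field, 'n::finite) block_matrix set topology" where
  "reduced_heisenberg_topology L =
     quotient_topology heisenberg_topology (\<lambda>x. central_lattice L #>\<^bsub>heisenberg_group\<^esub> x)"

definition pi0_Rep ::
  "'n itself \<Rightarrow> nat \<Rightarrow> 'f set \<Rightarrow>
     ((nat \<Rightarrow> int) \<Rightarrow> ('f::real_normed_field, 'n::finite) block_matrix set) set set set" where
  "pi0_Rep _ k L =
     path_components_of (Rep_space k (reduced_heisenberg_group L) (reduced_heisenberg_topology L))"

definition forget_flat_heisenberg ::
  "'n itself \<Rightarrow> nat \<Rightarrow> 'f set \<Rightarrow>
     ((nat \<Rightarrow> int) \<Rightarrow> ('f::real_normed_field, 'n::finite) block_matrix set) set set \<Rightarrow>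
     (nat \<times> nat \<Rightarrow> ('f, 'n) block_matrix)" where
  "forget_flat_heisenberg _ k L = forget_flat k heisenberg_group (central_lattice L)"

definition H2_heisenberg ::
  "'n itself \<Rightarrow> nat \<Rightarrow> 'f set \<Rightarrow>
     (nat \<times> nat \<Rightarrow> ('f::real_normed_field, 'n::finite) block_matrix) set" where
  "H2_heisenberg _ k L = Ant k (heisenberg_group\<lparr>carrier := central_lattice L\<rparr>)"

end

theory Submission
  imports Defs
begin

text \<open>
  Write elements of the Heisenberg group as pairs of a vector \<open>v\<close> in \<open>F\<^sup>2\<^sup>n\<close> and a central
  coordinate. The commutator of two elements is the standard symplectic form of their vectors, so
  a homomorphism from \<open>\<int>\<^sup>k\<close> to the quotient by the lattice \<open>L\<close> is a \<open>k\<close>-tuple of vectors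
  whose Gram matrix has entries in \<open>L\<close>, together with \<open>k\<close> arbitrary central coordinates modulo
  \<open>L\<close>. The forgetful map records the Gram matrix, which is constant along paths because \<open>L\<close>
  is countable.

  Injectivity: the tuples with a given Gram matrix form a path-connected set. Symplectic
  transvections, each joined to the identity by a path, carry one tuple to another one hyperbolic
  pair at a time; once no hyperbolic pair is left, what remains of the vectors is orthogonal to the
  chosen pairs and isotropic, so it can be scaled down to zero.

  Surjectivity: an alternating \<open>k \<times> k\<close> matrix splits into at most \<open>k div 2\<close> hyperbolic planes,
  so it is a Gram matrix if \<open>k div 2 \<le> n\<close>; otherwise the block matrix with \<open>k div 2\<close> unimodular
  \<open>2 \<times> 2\<close> blocks would force more than \<open>2n\<close> independent vectors.

  The only properties of the two lattices that matter are that they are countable additive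
  subgroups containing \<open>1\<close>.
\<close>


section \<open>Tuples of vectors with a prescribed Gram matrix\<close>

definition symplectic_form :: "'f::comm_ring_1 ^ ('n + 'n) \<Rightarrow> 'f ^ ('n::finite + 'n) \<Rightarrow> 'f" where
  "symplectic_form v w = (\<Sum>s\<in>UNIV. v $ Inl s * w $ Inr s - w $ Inl s * v $ Inr s)"

lemma symplectic_form_add_left:
  "symplectic_form (u + v) w = symplectic_form u w + symplectic_form v w"
  by (simp add: symplectic_form_def algebra_simps sum.distrib sum_subtractf)

lemma symplectic_form_add_right:
  "symplectic_form u (v + w) = symplectic_form u v + symplectic_form u w"
  by (simp add: symplectic_form_def algebra_simps sum.distrib sum_subtractf)

lemma symplectic_form_diff_left:
  "symplectic_form (u - v) w = symplectic_form u w - symplectic_form v w"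
  by (simp add: symplectic_form_def algebra_simps sum.distrib sum_subtractf)

lemma symplectic_form_diff_right:
  "symplectic_form u (v - w) = symplectic_form u v - symplectic_form u w"
  by (simp add: symplectic_form_def algebra_simps sum.distrib sum_subtractf)

lemma symplectic_form_scale_left: "symplectic_form (c *s v) w = c * symplectic_form v w"
  by (simp add: symplectic_form_def algebra_simps sum_distrib_left)

lemma symplectic_form_scale_right: "symplectic_form v (c *s w) = c * symplectic_form v w"
  by (simp add: symplectic_form_def algebra_simps sum_distrib_left)

lemma symplectic_form_zero [simp]: "symplectic_form 0 v = 0" "symplectic_form v 0 = 0"
  by (simp_all add: symplectic_form_def)

lemma symplectic_form_self [simp]: "symplectic_form v v = 0"
  by (simp add: symplectic_form_def algebra_simps)

lemma symplectic_form_swap: "symplectic_form w v = - symplectic_form v w"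
  by (simp add: symplectic_form_def sum_negf [symmetric])

lemmas symplectic_form_simps =
  symplectic_form_add_left symplectic_form_add_right
  symplectic_form_diff_left symplectic_form_diff_right
  symplectic_form_scale_left symplectic_form_scale_right

lemma symplectic_form_span_eq_0:
  fixes K :: "('f::field ^ ('n::finite + 'n)) set"
  assumes "p \<in> vec.span K" and "\<And>y. y \<in> K \<Longrightarrow> symplectic_form y x = 0"
  shows "symplectic_form p x = 0"
  using assms(1)
proof (induction rule: vec.span_induct_alt)
  case base
  then show ?case
    by simp
next
  case (step c y z)
  then show ?case
    using assms(2) by (simp add: symplectic_form_simps)
qed

lemma continuous_on_symplectic_form [continuous_intros]:
  fixes f g :: "'a::topological_space \<Rightarrow> 'f::real_normed_field ^ ('n::finite + 'n)"
  assumes "continuous_on S f" and "continuous_on S g"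
  shows "continuous_on S (\<lambda>x. symplectic_form (f x) (g x))"
  unfolding symplectic_form_def using assms by (intro continuous_intros)

lemma continuous_on_vector_scalar_mult [continuous_intros]:
  fixes f :: "'a::topological_space \<Rightarrow> 'f::real_normed_field ^ 'n::finite"
  assumes "continuous_on S c" and "continuous_on S f"
  shows "continuous_on S (\<lambda>x. c x *s f x)"
  unfolding vector_scalar_mult_def using assms by (intro continuous_intros)


section \<open>Transvections and paths of tuples with a fixed Gram matrix\<close>

definition transvection ::
  "'f::comm_ring_1 ^ ('n + 'n) \<Rightarrow> 'f \<Rightarrow> 'f ^ ('n::finite + 'n) \<Rightarrow> 'f ^ ('n + 'n)" where
  "transvection u c x = x + (c * symplectic_form u x) *s u"

text \<open>The two terms linear in \<open>c\<close> cancel because the form is alternating, and the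
  term quadratic in \<open>c\<close> contains \<open>symplectic_form u u = 0\<close>.\<close>

lemma symplectic_form_transvection:
  "symplectic_form (transvection u c x) (transvection u c y) = symplectic_form x y"
  by (simp add: transvection_def symplectic_form_simps symplectic_form_swap [of x u])

text \<open>Tuples are total functions so that the product topology of the function type applies;
  entries outside \<open>I\<close> are unconstrained.\<close>

definition gram_fibre ::
  "'i set \<Rightarrow> ('i \<Rightarrow> 'i \<Rightarrow> 'f) \<Rightarrow> ('i \<Rightarrow> 'f::comm_ring_1 ^ ('n::finite + 'n)) set" where
  "gram_fibre I M = {v. \<forall>i\<in>I. \<forall>j\<in>I. symplectic_form (v i) (v j) = M i j}"

lemma path_componentI:
  fixes \<gamma> :: "real \<Rightarrow> 'a::topological_space"
  assumes "continuous_on {0..1} \<gamma>" and "\<And>t. t \<in> {0..1} \<Longrightarrow> \<gamma> t \<in> S"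
  shows "path_component S (\<gamma> 0) (\<gamma> 1)"
  using assms unfolding path_component_def path_def path_image_def pathstart_def pathfinish_def
  by blast

text \<open>Scaling the coefficient from 0 to \<open>c\<close> joins the identity to the
  transvection, and each member of this family preserves the form, hence the Gram matrix.\<close>

lemma path_component_transvection:
  fixes v :: "'i \<Rightarrow> 'f::real_normed_field ^ ('n::finite + 'n)"
  assumes "v \<in> gram_fibre I M"
  shows "path_component (gram_fibre I M) v (\<lambda>i. transvection u c (v i))"
proof -
  let ?\<gamma> = "\<lambda>t i. transvection u (of_real t * c) (v i)"
  have "path_component (gram_fibre I M) (?\<gamma> 0) (?\<gamma> 1)"
  proof (rule path_componentI)
    show "continuous_on {0..1} ?\<gamma>"
      unfolding transvection_def by (intro continuous_intros)
    show "?\<gamma> t \<in> gram_fibre I M" for t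
      using assms by (simp add: gram_fibre_def symplectic_form_transvection)
  qed
  then show ?thesis
    by (simp add: transvection_def)
qed

text \<open>The transvection along \<open>b - v j\<close> is normalised by its pairing with
  \<open>v j\<close>, which equals \<open>symplectic_form b (v j)\<close>, so it adds exactly
  \<open>b - v j\<close> to \<open>v j\<close>. It fixes every \<open>v s\<close> orthogonal to
  \<open>b - v j\<close>.\<close>

lemma transvection_move_direct:
  fixes v :: "'i \<Rightarrow> 'f::real_normed_field ^ ('n::finite + 'n)"
  assumes "v \<in> gram_fibre I M" and "symplectic_form b (v j) \<noteq> 0"
    and "\<And>s. s \<in> S \<Longrightarrow> symplectic_form b (v s) = symplectic_form (v j) (v s)"
  shows "\<exists>v'. path_component (gram_fibre I M) v v' \<and> (\<forall>s\<in>S. v' s = v s) \<and> v' j = b"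
proof -
  let ?u = "b - v j" and ?c = "1 / symplectic_form b (v j)"
  let ?v = "\<lambda>i. transvection ?u ?c (v i)"
  have "?v j = b"
    using assms(2) by (simp add: transvection_def symplectic_form_simps)
  moreover have "\<forall>s\<in>S. ?v s = v s"
    using assms(3) by (simp add: transvection_def symplectic_form_simps)
  ultimately show ?thesis
    using path_component_transvection [OF assms(1)] by blast
qed

text \<open>Covers the case \<open>symplectic_form b (v j) = 0\<close>, where the direct move cannot
  be normalised, by two direct moves. The vector \<open>x\<close> detects \<open>v j\<close> and
  \<open>y\<close> detects \<open>b\<close>; if neither detects both, their sum does.\<close>

lemma transvection_move:
  fixes v :: "'i \<Rightarrow> 'f::real_normed_field ^ ('n::finite + 'n)"
  assumes v: "v \<in> gram_fibre I M"
    and eq: "\<And>s. s \<in> S \<Longrightarrow> symplectic_form b (v s) = symplectic_form (v j) (v s)"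
    and x: "\<And>s. s \<in> S \<Longrightarrow> symplectic_form x (v s) = 0" "symplectic_form x (v j) \<noteq> 0"
    and y: "\<And>s. s \<in> S \<Longrightarrow> symplectic_form y (v s) = 0" "symplectic_form y b \<noteq> 0"
  shows "\<exists>v'. path_component (gram_fibre I M) v v' \<and> (\<forall>s\<in>S. v' s = v s) \<and> v' j = b"
proof (cases "symplectic_form b (v j) = 0")
  case False
  then show ?thesis
    using transvection_move_direct [OF v _ eq] by blast
next
  case True
  \<comment> \<open>A detour through \<open>v j + z\<close>, for \<open>z\<close> one of \<open>x\<close>, \<open>y\<close>, \<open>x + y\<close>.\<close>
  have "\<exists>z. (\<forall>s\<in>S. symplectic_form z (v s) = 0) \<and>
      symplectic_form z (v j) \<noteq> 0 \<and> symplectic_form z b \<noteq> 0"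
  proof (cases "symplectic_form x b = 0")
    case False
    then show ?thesis
      using x by blast
  next
    case xb: True
    show ?thesis
    proof (cases "symplectic_form y (v j) = 0")
      case False
      then show ?thesis
        using y by blast
    next
      case True
      then show ?thesis
        using x y xb by (intro exI [of _ "x + y"]) (simp add: symplectic_form_simps)
    qed
  qed
  then obtain z where z: "\<And>s. s \<in> S \<Longrightarrow> symplectic_form z (v s) = 0"
      "symplectic_form z (v j) \<noteq> 0" "symplectic_form z b \<noteq> 0"
    by blast
  have "\<exists>v'. path_component (gram_fibre I M) v v' \<and> (\<forall>s\<in>S. v' s = v s) \<and> v' j = v j + z"
    using z by (intro transvection_move_direct [OF v]) (simp_all add: symplectic_form_simps)
  then obtain v' where v': "path_component (gram_fibre I M) v v'" "\<And>s. s \<in> S \<Longrightarrow> v' s = v s"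
      "v' j = v j + z"
    by blast
  have "v' \<in> gram_fibre I M"
    using v'(1) path_component_mem(2) by blast
  moreover have "symplectic_form b (v' j) \<noteq> 0"
    using True z(3) v'(3) symplectic_form_swap [of b z] by (simp add: symplectic_form_simps)
  moreover have "symplectic_form b (v' s) = symplectic_form (v' j) (v' s)" if "s \<in> S" for s
    using that v' z eq by (simp add: symplectic_form_simps)
  ultimately obtain v'' where "path_component (gram_fibre I M) v' v''" "\<forall>s\<in>S. v'' s = v' s"
      "v'' j = b"
    using transvection_move_direct [of v' I M b j S] by blast
  then show ?thesis
    using v' path_component_trans by (metis (no_types, lifting))
qed

section \<open>Nondegenerate spans and connectedness of the Gram fibre\<close>

text \<open>The span of \<open>K\<close> and its symplectic complement together fill the space,
  which amounts to nondegeneracy of the form on the span. The witness \<open>p\<close> is the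
  projection of \<open>x\<close> to the span.\<close>

definition orthogonally_splits :: "('f::field ^ ('n::finite + 'n)) set \<Rightarrow> bool" where
  "orthogonally_splits K \<longleftrightarrow>
     (\<forall>x. \<exists>p\<in>vec.span K. \<forall>y\<in>K. symplectic_form y (x - p) = 0)"

text \<open>One step of symplectic Gram-Schmidt: \<open>a - p\<close> and \<open>b - r\<close> span
  a hyperbolic plane orthogonal to \<open>K\<close>, so the projection to the larger span is the old
  one plus the projection to this plane.\<close>

lemma orthogonally_splits_insert:
  fixes K :: "('f::field ^ ('n::finite + 'n)) set"
  assumes K: "orthogonally_splits K"
    and p: "p \<in> vec.span K" "\<And>y. y \<in> K \<Longrightarrow> symplectic_form y (a - p) = 0"
    and r: "r \<in> vec.span K" "\<And>y. y \<in> K \<Longrightarrow> symplectic_form y (b - r) = 0"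
    and ab: "symplectic_form (a - p) (b - r) \<noteq> 0"
  shows "orthogonally_splits (insert a (insert b K))"
  unfolding orthogonally_splits_def
proof
  fix x
  let ?K = "insert a (insert b K)"
  let ?d = "symplectic_form (a - p) (b - r)"
  obtain m where m: "m \<in> vec.span K" "\<And>y. y \<in> K \<Longrightarrow> symplectic_form y (x - m) = 0"
    using K unfolding orthogonally_splits_def by blast
  \<comment> \<open>The coefficients \<open>c\<close> and \<open>e\<close> solve the two linear
    equations making the remainder \<open>z\<close> orthogonal to \<open>b - r\<close> and to
    \<open>a - p\<close>.\<close>
  define c where "c = symplectic_form (x - m) (b - r) / ?d"
  define e where "e = symplectic_form (a - p) (x - m) / ?d"
  define z where "z = x - m - c *s (a - p) - e *s (b - r)"
  have sub: "vec.span K \<subseteq> vec.span ?K"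
    by (rule vec.span_mono) blast
  have "a \<in> vec.span ?K" "b \<in> vec.span ?K"
    by (simp_all add: vec.span_base)
  then have in_span: "m + c *s (a - p) + e *s (b - r) \<in> vec.span ?K"
    using sub m(1) p(1) r(1) by (intro vec.span_add vec.span_scale vec.span_diff) auto
  have z_eq: "x - (m + c *s (a - p) + e *s (b - r)) = z"
    by (simp add: z_def)
  have zK: "symplectic_form y z = 0" if "y \<in> K" for y
    unfolding z_def
    using p(2) [OF that] r(2) [OF that] m(2) [OF that]
    by (simp only: symplectic_form_diff_right [of y "_ - _"] symplectic_form_scale_right
        mult_zero_right diff_zero)
  have "symplectic_form (a - p) z = 0"
    using ab unfolding z_def e_def
    by (simp only: symplectic_form_diff_right [of "a - p" "_ - _ "] symplectic_form_diff_right [of "a - p" "x - m"] symplectic_form_scale_right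
        symplectic_form_self) simp
  \<comment> \<open>Since \<open>p\<close> lies in the span of \<open>K\<close>, which is orthogonal
    to \<open>z\<close>, passing from \<open>a - p\<close> to \<open>a\<close> does not change the
    pairing.\<close>
  then have za: "symplectic_form a z = 0"
    using symplectic_form_span_eq_0 [OF p(1) zK] by (simp add: symplectic_form_diff_left)
  have "symplectic_form z (b - r) = 0"
    using ab unfolding z_def c_def
    by (simp only: symplectic_form_diff_left [of "_ - _ " _ "b - r"] symplectic_form_diff_left [of "x - m" _ "b - r"] symplectic_form_scale_left
        symplectic_form_self) simp
  then have "symplectic_form (b - r) z = 0"
    using symplectic_form_swap [of "b - r" z] by simp
  then have "symplectic_form b z = 0"
    using symplectic_form_span_eq_0 [OF r(1) zK] by (simp add: symplectic_form_diff_left)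
  with za zK have "\<forall>y\<in>?K. symplectic_form y (x - (m + c *s (a - p) + e *s (b - r))) = 0"
    unfolding z_eq by blast
  with in_span show "\<exists>p\<in>vec.span ?K. \<forall>y\<in>?K. symplectic_form y (x - p) = 0"
    by blast
qed

text \<open>Scaling the differences \<open>v i - p i\<close> to zero leaves the Gram matrix
  unchanged: the mixed terms vanish by \<open>orth\<close> and the quadratic term by
  \<open>isotropic\<close>.\<close>

lemma gram_fibre_contract:
  fixes v :: "'i \<Rightarrow> 'f::real_normed_field ^ ('n::finite + 'n)"
  assumes v: "v \<in> gram_fibre I M"
    and orth: "\<And>i j. i \<in> I \<Longrightarrow> j \<in> I \<Longrightarrow> symplectic_form (p i) (v j - p j) = 0"
    and isotropic: "\<And>i j. i \<in> I \<Longrightarrow> j \<in> I \<Longrightarrow> symplectic_form (v i - p i) (v j - p j) = 0"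
  shows "path_component (gram_fibre I M) v p"
proof -
  let ?\<gamma> = "\<lambda>t i. p i + of_real (1 - t) *s (v i - p i)"
  have "path_component (gram_fibre I M) (?\<gamma> 0) (?\<gamma> 1)"
  proof (rule path_componentI)
    show "continuous_on {0..1} ?\<gamma>"
      by (intro continuous_intros)
    have "symplectic_form (?\<gamma> t i) (?\<gamma> t j) = M i j" if "i \<in> I" "j \<in> I" for t i j
    proof -
      have orth': "symplectic_form (v i - p i) (p j) = 0"
        using orth [OF that(2,1)] symplectic_form_swap [of "v i - p i" "p j"] by simp
      have "symplectic_form (?\<gamma> t i) (?\<gamma> t j) = symplectic_form (p i) (p j)"
        using orth [OF that] orth' isotropic [OF that]
        by (simp only: symplectic_form_add_left symplectic_form_add_right
            symplectic_form_scale_left symplectic_form_scale_right) simp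
      also have "\<dots> = symplectic_form (p i + (v i - p i)) (p j + (v j - p j))"
        using orth [OF that] orth' isotropic [OF that]
        by (simp only: symplectic_form_add_left symplectic_form_add_right) simp
      also have "\<dots> = M i j"
        using v that by (simp add: gram_fibre_def)
      finally show ?thesis .
    qed
    then show "?\<gamma> t \<in> gram_fibre I M" for t
      by (simp add: gram_fibre_def)
  qed
  then show ?thesis
    by simp
qed

text \<open>
  Induction over the complement of \<open>S\<close>: the tuples already agree on \<open>S\<close>, whose vectors span
  a nondegenerate subspace. If the components orthogonal to it still contain a hyperbolic pair,
  that pair is moved into place and joins \<open>S\<close>; otherwise both tuples contract to their
  projections, which coincide since they only depend on the Gram matrix.
\<close>

lemma gram_fibre_connect:
  fixes v w :: "'i \<Rightarrow> 'f::real_normed_field ^ ('n::finite + 'n)"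
  assumes "finite I" and "S \<subseteq> I" and "v \<in> gram_fibre I M" and "w \<in> gram_fibre I M"
    and "\<And>s. s \<in> S \<Longrightarrow> v s = w s" and "orthogonally_splits (w ` S)"
  shows "path_component (gram_fibre I M) v w"
  using assms(2-6)
proof (induction "card (I - S)" arbitrary: S v rule: less_induct)
  case less
  note v = less.prems(2) and w = less.prems(3) and vw = less.prems(4) and S = less.prems(1)
  have gram: "symplectic_form (v i) (v j) = symplectic_form (w i) (w j)" if "i \<in> I" "j \<in> I" for i j
    using v w that by (simp add: gram_fibre_def)
  have "\<forall>i. \<exists>p\<in>vec.span (w ` S). \<forall>y\<in>w ` S. symplectic_form y (w i - p) = 0"
    using less.prems(5) unfolding orthogonally_splits_def by blast
  then obtain p where p: "\<And>i. p i \<in> vec.span (w ` S)"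
    and wp: "\<And>s i. s \<in> S \<Longrightarrow> symplectic_form (w s) (w i - p i) = 0"
    by (metis image_eqI)
  have span_perp: "symplectic_form x y = 0"
    if "x \<in> vec.span (w ` S)" "\<And>s. s \<in> S \<Longrightarrow> symplectic_form (w s) y = 0" for x y
    by (rule symplectic_form_span_eq_0 [OF that(1)]) (use that(2) in blast)
  \<comment> \<open>The projection \<open>p i\<close> of \<open>w i\<close> is also that of
    \<open>v i\<close>: pairings with vectors indexed by \<open>S\<close> are Gram entries, and
    \<open>v\<close> and \<open>w\<close> agree on \<open>S\<close>.\<close>
  have vp: "symplectic_form (w s) (v i - p i) = 0" if "s \<in> S" "i \<in> I" for s i
    using wp [OF that(1), of i] gram [of s i] vw [OF that(1)] that S
    by (auto simp: symplectic_form_diff_right)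
  show ?case
  proof (cases "\<forall>i\<in>I. \<forall>j\<in>I. symplectic_form (w i - p i) (w j - p j) = 0")
    case True
    have pv: "symplectic_form (p i) (v j - p j) = 0" if "j \<in> I" for i j
      using span_perp [OF p] vp that by blast
    have pw: "symplectic_form (p i) (w j - p j) = 0" for i j
      using span_perp [OF p] wp by blast
    have "symplectic_form (v i - p i) (v j - p j) = 0" if "i \<in> I" "j \<in> I" for i j
    proof -
      \<comment> \<open>Each side expands to the common Gram entry minus
        \<open>symplectic_form (p i) (p j)\<close>.\<close>
      have "symplectic_form (v i - p i) (v j - p j) = symplectic_form (w i - p i) (w j - p j)"
        using pv [OF that(2), of i] pv [OF that(1), of j] pw [of i j] pw [of j i] gram [OF that]
          symplectic_form_swap [of "v i" "p j"] symplectic_form_swap [of "w i" "p j"]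
          symplectic_form_swap [of "p i" "p j"]
        by (simp add: symplectic_form_simps) (metis add_right_cancel)
      then show ?thesis
        using True that by simp
    qed
    then have "path_component (gram_fibre I M) v p"
      using gram_fibre_contract [OF v] pv by blast
    moreover have "path_component (gram_fibre I M) w p"
      using gram_fibre_contract [OF w] pw True by blast
    ultimately show ?thesis
      using path_component_sym path_component_trans by blast
  next
    case False
    then obtain j l where j: "j \<in> I" and l: "l \<in> I"
      and jl: "symplectic_form (w j - p j) (w l - p l) \<noteq> 0"
      by blast
    have span_S: "w s - p i \<in> vec.span (w ` S)" if "s \<in> S" for s i
      using p that by (intro vec.span_diff) (auto intro: vec.span_base)
    have "j \<notin> S"
      using span_perp [OF span_S wp] jl by blast
    have qp: "symplectic_form (w i - p i) (p m) = 0" for i m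
      using span_perp [OF p wp, of m i] symplectic_form_swap [of "w i - p i" "p m"] by simp
    have qw: "symplectic_form (w i - p i) (w m) = symplectic_form (w i - p i) (w m - p m)" for i m
      using qp [of i m] by (simp add: symplectic_form_diff_right)
    have p_cong: "symplectic_form (p i) x = symplectic_form (p i) y"
      if "\<And>s. s \<in> S \<Longrightarrow> symplectic_form (w s) x = symplectic_form (w s) y" for i x y
      using span_perp [OF p, of "x - y" i] that by (simp add: symplectic_form_diff_right)
    have w_cong: "symplectic_form (w s) (v i) = symplectic_form (w s) (w i)"
      if "s \<in> S" "i \<in> I" for s i
      using gram [of s i] that vw S by auto
    have w_perp: "symplectic_form (w i - p i) (w s) = 0" "symplectic_form (v i - p i) (w s) = 0"
      if "s \<in> S" "i \<in> I" for s i
      using wp [OF that(1), of i] vp [OF that] symplectic_form_swap [of _ "w s"] by simp_all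
    have jl': "symplectic_form (w l - p l) (w j) \<noteq> 0"
      using jl qw [of l j] symplectic_form_swap [of "w l - p l" "w j - p j"] by simp
    moreover have "symplectic_form (v l - p l) (v j) = symplectic_form (w l - p l) (w j)"
      using p_cong [OF w_cong [OF _ j], of l] gram [OF l j] by (simp add: symplectic_form_diff_left)
    ultimately have vl: "symplectic_form (v l - p l) (v j) \<noteq> 0"
      by simp
    \<comment> \<open>First move, for the index \<open>j\<close>: the auxiliary vectors are
      \<open>v l - p l\<close>, which detects \<open>v j\<close>, and \<open>w l - p l\<close>,
      which detects \<open>w j\<close>.\<close>
    have "\<exists>v'. path_component (gram_fibre I M) v v' \<and> (\<forall>s\<in>S. v' s = v s) \<and> v' j = w j"
    proof (rule transvection_move [OF v _ _ vl _ jl'])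
      show "symplectic_form (w j) (v s) = symplectic_form (v j) (v s)" if "s \<in> S" for s
        using gram [OF j, of s] that vw S by auto
    qed (use w_perp vw l in simp_all)
    then obtain v' where v': "path_component (gram_fibre I M) v v'"
        "\<And>s. s \<in> S \<Longrightarrow> v' s = v s" "v' j = w j"
      by blast
    have v'_mem: "v' \<in> gram_fibre I M"
      using v'(1) path_component_mem(2) by blast
    \<comment> \<open>Second move, for the index \<open>l\<close>, with \<open>j\<close> now held
      fixed too. The single vector \<open>w j - p j\<close> plays both auxiliary roles; it is
      orthogonal to \<open>w j\<close> because that pairing equals its pairing with itself.\<close>
    have "\<exists>v''. path_component (gram_fibre I M) v' v'' \<and> (\<forall>s\<in>insert j S. v'' s = v' s) \<and> v'' l = w l"
    proof (rule transvection_move [OF v'_mem])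
      have v'_gram: "symplectic_form (w s) (v' l) = symplectic_form (w s) (w l)"
        if "s \<in> insert j S" for s
      proof -
        have "w s = v' s" "s \<in> I"
          using that v' vw S j by auto
        then show ?thesis
          using v'_mem w l by (auto simp: gram_fibre_def)
      qed
      have v'w: "v' s = w s" if "s \<in> insert j S" for s
        using that v' vw by auto
      show "symplectic_form (w l) (v' s) = symplectic_form (v' l) (v' s)" if "s \<in> insert j S" for s
        using v'_gram [OF that] v'w [OF that] symplectic_form_swap [of _ "w s"] by metis
      have perp: "symplectic_form (w j - p j) (v' s) = 0" if "s \<in> insert j S" for s
        using that w_perp(1) [OF _ j] qw [of j j] v'w [OF that] by auto
      then show "symplectic_form (w j - p j) (v' s) = 0" "symplectic_form (w j - p j) (v' s) = 0"
        if "s \<in> insert j S" for s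
        using that by blast+
      show "symplectic_form (w j - p j) (w l) \<noteq> 0"
        using jl qw by simp
      moreover have "symplectic_form (w j - p j) (v' l) = symplectic_form (w j - p j) (w l)"
        using p_cong [of "v' l" "w l" j] v'_gram by (simp add: symplectic_form_diff_left)
      ultimately show "symplectic_form (w j - p j) (v' l) \<noteq> 0"
        by simp
    qed
    then obtain v'' where v'': "path_component (gram_fibre I M) v' v''"
        "\<And>s. s \<in> insert j S \<Longrightarrow> v'' s = v' s" "v'' l = w l"
      by blast
    have "path_component (gram_fibre I M) v'' w"
    proof (rule less.hyps)
      show "insert j (insert l S) \<subseteq> I"
        using S j l by blast
      show "v'' \<in> gram_fibre I M"
        using v''(1) path_component_mem(2) by blast
      have "I - insert j (insert l S) \<subset> I - S"
        using j \<open>j \<notin> S\<close> by blast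
      then show "card (I - insert j (insert l S)) < card (I - S)"
        using assms(1) by (intro psubset_card_mono) auto
      show "v'' s = w s" if "s \<in> insert j (insert l S)" for s
        using that v' v'' vw by auto
      show "orthogonally_splits (w ` insert j (insert l S))"
        using orthogonally_splits_insert [OF less.prems(5) p _ p _ jl] wp by auto
    qed (use w in auto)
    then show ?thesis
      using path_component_trans [OF v'(1) path_component_trans [OF v''(1)]] by simp
  qed
qed

proposition path_connected_gram_fibre:
  fixes M :: "'i \<Rightarrow> 'i \<Rightarrow> 'f::real_normed_field"
  assumes "finite I"
  shows "path_connected (gram_fibre I M :: ('i \<Rightarrow> 'f ^ ('n::finite + 'n)) set)"
  unfolding path_connected_component
proof (intro ballI)
  fix v w :: "'i \<Rightarrow> 'f ^ ('n + 'n)"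
  assume "v \<in> gram_fibre I M" "w \<in> gram_fibre I M"
  moreover have "orthogonally_splits ({} :: ('f ^ ('n + 'n)) set)"
    by (simp add: orthogonally_splits_def)
  ultimately show "path_component (gram_fibre I M) v w"
    using gram_fibre_connect [OF assms, of "{}" v M w] by simp
qed


section \<open>Alternating matrices as Gram matrices\<close>

lemma symplectic_form_axis_left:
  "symplectic_form (axis (Inl s) c) w = c * w $ Inr s"
  "symplectic_form (axis (Inr s) c) w = - (c * w $ Inl s)"
proof -
  have "symplectic_form (axis (Inl s) c) w = (\<Sum>r\<in>UNIV. if r = s then c * w $ Inr r else 0)"
    unfolding symplectic_form_def by (rule sum.cong) (simp_all add: axis_def)
  then show "symplectic_form (axis (Inl s) c) w = c * w $ Inr s"
    by simp
  have "symplectic_form (axis (Inr s) c) w = (\<Sum>r\<in>UNIV. if r = s then - (c * w $ Inl r) else 0)"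
    unfolding symplectic_form_def by (rule sum.cong) (simp_all add: axis_def)
  then show "symplectic_form (axis (Inr s) c) w = - (c * w $ Inl s)"
    by simp
qed

text \<open>\<open>T\<close> indexes the hyperbolic coordinate planes still available. Each step
  spends one plane on a nonzero entry and removes two indices, while the support condition keeps the
  spent plane orthogonal to the rest. The \<open>+ 1\<close> is harmless: an alternating matrix with
  one index is zero.\<close>

lemma alternating_realizable_aux:
  fixes M :: "'i \<Rightarrow> 'i \<Rightarrow> 'f::field"
  assumes "finite T" and "finite J" and "card J \<le> 2 * card T + 1"
    and "\<And>i. i \<in> J \<Longrightarrow> M i i = 0"
    and "\<And>i j. i \<in> J \<Longrightarrow> j \<in> J \<Longrightarrow> M j i = - M i j"
  shows "\<exists>v :: 'i \<Rightarrow> 'f ^ ('n::finite + 'n).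
    (\<forall>i s. s \<notin> T \<longrightarrow> v i $ Inl s = 0 \<and> v i $ Inr s = 0) \<and>
    (\<forall>i\<in>J. \<forall>j\<in>J. symplectic_form (v i) (v j) = M i j)"
  using assms
proof (induction T arbitrary: J M rule: finite_induct)
  case empty
  have "\<forall>i\<in>J. \<forall>j\<in>J. i = j"
    using empty.prems(1,2) by (simp add: card_le_Suc0_iff_eq)
  then have "\<forall>i\<in>J. \<forall>j\<in>J. M i j = 0"
    using empty.prems(3) by metis
  then show ?case
    by (intro exI [of _ "\<lambda>_. 0"]) simp
next
  case (insert t T)
  note diag = insert.prems(3) and anti = insert.prems(4)
  show ?case
  proof (cases "\<forall>i\<in>J. \<forall>j\<in>J. M i j = 0")
    case True
    then show ?thesis
      by (intro exI [of _ "\<lambda>_. 0"]) simp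
  next
    case False
    then obtain j l where j: "j \<in> J" and l: "l \<in> J" and jl: "M j l \<noteq> 0"
      by blast
    \<comment> \<open>Subtracting the hyperbolic plane \<open>a x * b y - a y * b x\<close> clears the rows and columns \<open>j\<close>, \<open>l\<close>.\<close>
    define a b where "a = (\<lambda>x. M x l / M j l)" and "b = (\<lambda>x. M j x)"
    define N where "N = (\<lambda>x y. M x y - (a x * b y - a y * b x))"
    have "j \<noteq> l"
      using jl diag j by blast
    \<comment> \<open>Here \<open>a j = 1\<close>, \<open>a l = 0\<close>, \<open>b j = 0\<close>
      and \<open>b l = M j l\<close>, so the subtracted term agrees with \<open>M\<close> in these
      rows and columns.\<close>
    have N0: "N x j = 0" "N x l = 0" "N j x = 0" "N l x = 0" if "x \<in> J" for x
      using jl anti [of x j] anti [of x l] anti [of j l] diag [of j] diag [of l] that j l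
      by (simp_all add: N_def a_def b_def)
    let ?J = "J - {j, l}"
    have "card ?J \<le> 2 * card T + 1"
      using insert.prems(1,2) insert.hyps j l \<open>j \<noteq> l\<close> card_Diff_subset [of "{j, l}" J]
      by simp
    moreover have "N y x = - N x y" if "x \<in> ?J" "y \<in> ?J" for x y
      using anti [of x y] that by (simp add: N_def)
    moreover have "N x x = 0" if "x \<in> ?J" for x
      using diag [of x] that by (simp add: N_def)
    ultimately obtain v' :: "'i \<Rightarrow> 'f ^ ('n + 'n)"
      where v'0: "\<And>i s. s \<notin> T \<Longrightarrow> v' i $ Inl s = 0 \<and> v' i $ Inr s = 0"
        and v': "\<And>x y. x \<in> ?J \<Longrightarrow> y \<in> ?J \<Longrightarrow> symplectic_form (v' x) (v' y) = N x y"
      using insert.IH [OF finite_Diff [OF insert.prems(1)], of "{j, l}" N] by blast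
    \<comment> \<open>The induction hypothesis says nothing about the pairings at \<open>j\<close>
      and \<open>l\<close>; the value 0 is right there because \<open>N\<close> vanishes in those
      rows and columns.\<close>
    define u where "u = (\<lambda>x. if x \<in> ?J then v' x else 0)"
    \<comment> \<open>The component in the fresh plane \<open>t\<close>, whose pairings restore the
      hyperbolic term that was subtracted from \<open>M\<close>.\<close>
    define h where "h = (\<lambda>x. axis (Inl t) (a x) + axis (Inr t) (b x) :: 'f ^ ('n + 'n))"
    have u0: "u x $ Inl s = 0" "u x $ Inr s = 0" if "s \<notin> T" for x s
      using v'0 [OF that] by (simp_all add: u_def)
    have uu: "symplectic_form (u x) (u y) = N x y" if "x \<in> J" "y \<in> J" for x y
      using that v' N0 by (auto simp: u_def)
    have hu: "symplectic_form (h x) (u y) = 0" for x y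
      using u0 insert.hyps(2) by (simp add: h_def symplectic_form_simps symplectic_form_axis_left)
    have hh: "symplectic_form (h x) (h y) = a x * b y - a y * b x" for x y
      by (simp add: h_def symplectic_form_add_left symplectic_form_axis_left) (simp add: axis_def)
    have uh: "symplectic_form (u x) (h y) = 0" for x y
      using hu [of y x] symplectic_form_swap [of "u x" "h y"] by simp
    have "symplectic_form (u x + h x) (u y + h y) = M x y" if "x \<in> J" "y \<in> J" for x y
      using uu [OF that] hu uh hh
      by (simp add: symplectic_form_add_left symplectic_form_add_right N_def)
    moreover have "(u x + h x) $ Inl s = 0 \<and> (u x + h x) $ Inr s = 0" if "s \<notin> insert t T" for x s
      using u0 [of s x] that by (simp add: h_def axis_def)
    ultimately show ?thesis
      by (intro exI [of _ "\<lambda>x. u x + h x"]) blast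
  qed
qed

lemma alternating_realizable:
  fixes M :: "'i \<Rightarrow> 'i \<Rightarrow> 'f::field"
  assumes "finite J" and "card J \<le> 2 * CARD('n::finite) + 1"
    and "\<And>i. i \<in> J \<Longrightarrow> M i i = 0"
    and "\<And>i j. i \<in> J \<Longrightarrow> j \<in> J \<Longrightarrow> M j i = - M i j"
  shows "(gram_fibre J M :: ('i \<Rightarrow> 'f ^ ('n + 'n)) set) \<noteq> {}"
proof -
  have "\<exists>v :: 'i \<Rightarrow> 'f ^ ('n + 'n). (\<forall>i s. s \<notin> UNIV \<longrightarrow> v i $ Inl s = 0 \<and> v i $ Inr s = 0) \<and>
      (\<forall>i\<in>J. \<forall>j\<in>J. symplectic_form (v i) (v j) = M i j)"
    by (rule alternating_realizable_aux [OF finite_class.finite_UNIV assms])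
  then show ?thesis
    unfolding gram_fibre_def by auto
qed

section \<open>The obstruction when there are too few hyperbolic planes\<close>

text \<open>Pairing with \<open>u i\<close> kills the span of all the other vectors but not
  \<open>v i\<close>, so the family is linearly independent in a space of dimension
  \<open>2 * CARD('n)\<close>.\<close>

lemma card_le_of_dual_family:
  fixes v :: "'i \<Rightarrow> 'f::field ^ ('n::finite + 'n)"
  assumes "finite J"
    and dual: "\<And>i. i \<in> J \<Longrightarrow> symplectic_form (v i) (u i) \<noteq> 0"
    and off: "\<And>i j. i \<in> J \<Longrightarrow> j \<in> J \<Longrightarrow> j \<noteq> i \<Longrightarrow> symplectic_form (v j) (u i) = 0"
  shows "card J \<le> 2 * CARD('n)"
proof -
  have "inj_on v J"
    using dual off by (metis (no_types, lifting) inj_onI)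
  have "\<not> vec.dependent (v ` J)"
    unfolding vec.dependent_def
  proof safe
    fix i
    assume i: "i \<in> J" and span: "v i \<in> vec.span (v ` J - {v i})"
    have "symplectic_form (v i) (u i) = 0"
      using off i by (intro symplectic_form_span_eq_0 [OF span]) auto
    with dual i show False
      by blast
  qed
  then have "card (v ` J) \<le> vec.dim (UNIV :: ('f ^ ('n + 'n)) set)"
    using vec.independent_card_le_dim by blast
  also have "\<dots> = CARD('n + 'n)"
    by (rule vec_dim_card)
  also have "\<dots> = 2 * CARD('n)"
    by (simp add: UNIV_Plus_UNIV [symmetric] card_Plus del: UNIV_Plus_UNIV)
  finally show ?thesis
    using \<open>inj_on v J\<close> by (simp add: card_image)
qed

text \<open>Pairs each even index with its successor. Being defined on all naturals, it gives a zero
  last row inside the range when \<open>k\<close> is odd, since the partner of \<open>k - 1\<close>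
  is then \<open>k\<close>.\<close>

definition block_matrix_entry :: "nat \<Rightarrow> nat \<Rightarrow> 'f::ring_1" where
  "block_matrix_entry i j =
     (if even i \<and> j = Suc i then 1 else if odd i \<and> i = Suc j then - 1 else 0)"

lemma block_matrix_entry_antisym:
  "block_matrix_entry j i = - (block_matrix_entry i j :: 'f::ring_1)"
  by (auto simp: block_matrix_entry_def)

lemma block_matrix_not_realizable:
  assumes "\<not> k div 2 \<le> CARD('n::finite)"
  shows "(gram_fibre {..<k} block_matrix_entry :: (nat \<Rightarrow> 'f::field ^ ('n + 'n)) set) = {}"
proof (rule ccontr)
  assume "(gram_fibre {..<k} block_matrix_entry :: (nat \<Rightarrow> 'f ^ ('n + 'n)) set) \<noteq> {}"
  then obtain v :: "nat \<Rightarrow> 'f ^ ('n + 'n)" where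
    v: "symplectic_form (v i) (v j) = block_matrix_entry i j" if "i < k" "j < k" for i j
    unfolding gram_fibre_def by fastforce
  \<comment> \<open>Rounding down to an even number drops the unpaired last index of an odd
    \<open>k\<close>; every remaining vector has its partner as dual vector.\<close>
  let ?m = "2 * (k div 2)"
  define partner where "partner i = (if even i then Suc i else i - 1)" for i :: nat
  have less: "i < k" "partner i < k" if "i < ?m" for i
    using that unfolding partner_def by presburger+
  have "card {..<?m} \<le> 2 * CARD('n)"
  proof (rule card_le_of_dual_family)
    show "symplectic_form (v i) (v (partner i)) \<noteq> 0" if "i \<in> {..<?m}" for i
      using that v less by (auto simp: block_matrix_entry_def partner_def elim: oddE)
    show "symplectic_form (v j) (v (partner i)) = 0"
      if "i \<in> {..<?m}" "j \<in> {..<?m}" "j \<noteq> i" for i j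
    proof -
      have "\<not> (even j \<and> partner i = Suc j)" "\<not> (odd j \<and> j = Suc (partner i))"
        using that(3) unfolding partner_def by presburger+
      then show ?thesis
        using that v less by (simp add: block_matrix_entry_def)
    qed
  qed simp
  with assms show False
    by simp
qed


section \<open>The Heisenberg group and its central quotient\<close>

definition heis :: "'f::real_normed_field ^ ('n + 'n) \<Rightarrow> 'f \<Rightarrow> ('f, 'n::finite) block_matrix" where
  "heis v z = heisenberg_matrix (\<chi> s. v $ Inl s) (\<chi> s. v $ Inr s) z"

definition vector_part :: "('f, 'n) block_matrix \<Rightarrow> 'f ^ ('n::finite + 'n)" where
  "vector_part m = (\<chi> s. case s of Inl i \<Rightarrow> m $ First $ Mid i | Inr i \<Rightarrow> m $ Mid i $ Last)"

text \<open>The bilinear cocycle of the Heisenberg group as a central extension of the vectors. It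
  is not antisymmetric; antisymmetrising it gives the symplectic form.\<close>

definition half_form :: "'f::comm_ring_1 ^ ('n + 'n) \<Rightarrow> 'f ^ ('n::finite + 'n) \<Rightarrow> 'f" where
  "half_form v w = (\<Sum>s\<in>UNIV. v $ Inl s * w $ Inr s)"

lemma half_form_diff: "half_form v w - half_form w v = symplectic_form v w"
  by (simp add: half_form_def symplectic_form_def sum_subtractf)

lemma half_form_simps [simp]:
  "half_form 0 v = 0" "half_form v 0 = 0"
  "half_form (- v) w = - half_form v w" "half_form v (- w) = - half_form v w"
  "half_form (u + v) w = half_form u w + half_form v w"
  "half_form u (v + w) = half_form u v + half_form u w"
  "half_form (u - v) w = half_form u w - half_form v w"
  "half_form u (v - w) = half_form u v - half_form u w"
  by (simp_all add: half_form_def sum_negf algebra_simps sum.distrib sum_subtractf)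

lemma vector_part_heis [simp]: "vector_part (heis v z) = v"
  by (simp add: vector_part_def heis_def heisenberg_matrix_def vec_eq_iff split: sum.split)

lemma heis_corner [simp]: "heis v z $ First $ Last = z"
  by (simp add: heis_def heisenberg_matrix_def)

lemma heis_eq_iff [simp]: "heis v z = heis w y \<longleftrightarrow> v = w \<and> z = y"
  by (metis vector_part_heis heis_corner)

lemma heisenberg_matrix_eq_heis:
  "heisenberg_matrix a b z = heis (\<chi> s. case s of Inl i \<Rightarrow> a $ i | Inr i \<Rightarrow> b $ i) z"
  by (simp add: heis_def)

lemma carrier_heisenberg_group:
  "carrier heisenberg_group =
     {heis v z | (v :: 'f::real_normed_field ^ ('n::finite + 'n)) z. True}"
proof -
  have "\<exists>a b. heis v z = heisenberg_matrix a b z" for v :: "'f ^ ('n + 'n)" and z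
    unfolding heis_def by blast
  then show ?thesis
    unfolding heisenberg_group_def using heisenberg_matrix_eq_heis by fastforce
qed

lemma heis_in_carrier [simp]: "heis v z \<in> carrier heisenberg_group"
  by (auto simp: carrier_heisenberg_group)

lemma sum_block_index:
  "(\<Sum>i\<in>UNIV. f i) = f First + f Last + (\<Sum>i\<in>UNIV. f (Mid (i :: 'n::finite)))"
proof -
  have UNIV: "UNIV = insert First (insert Last (range (Mid :: 'n \<Rightarrow> 'n block_index)))"
    by (rule UNIV_eq_I) (metis block_index.exhaust insertI1 insertI2 rangeI)
  have "(\<Sum>i\<in>range (Mid :: 'n \<Rightarrow> 'n block_index). f i) = (\<Sum>i\<in>UNIV. f (Mid i))"
    by (subst sum.reindex) (simp_all add: inj_on_def)
  then show ?thesis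
    by (subst UNIV) (auto simp: add.assoc image_iff)
qed

lemma heis_matrix_mult: "heis v z ** heis w y = heis (v + w) (z + y + half_form v w)"
proof -
  have "(heis v z ** heis w y) $ r $ c = heis (v + w) (z + y + half_form v w) $ r $ c" for r c
    by (cases r; cases c)
      (simp_all add: matrix_matrix_mult_def sum_block_index heis_def heisenberg_matrix_def
        half_form_def add_ac if_distrib [of "\<lambda>x. x * _"] if_distrib [of "\<lambda>x. _ * x"]
        cong: if_cong)
  then show ?thesis
    by (simp add: vec_eq_iff)
qed

lemma heis_0_0: "heis 0 0 = mat 1"
proof -
  have "heis 0 0 $ r $ c = (mat 1 :: ('a, 'b) block_matrix) $ r $ c" for r c
    by (cases r; cases c) (simp_all add: heis_def heisenberg_matrix_def mat_def)
  then show ?thesis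
    by (simp add: vec_eq_iff)
qed

lemma mult_heisenberg_group [simp]:
  "heis v z \<otimes>\<^bsub>heisenberg_group\<^esub> heis w y = heis (v + w) (z + y + half_form v w)"
  by (simp add: heisenberg_group_def heis_matrix_mult)

lemma one_heisenberg_group: "\<one>\<^bsub>heisenberg_group\<^esub> = heis 0 0"
  by (simp add: heisenberg_group_def heis_0_0)

lemma group_heisenberg_group: "group heisenberg_group"
proof (rule groupI)
  fix x :: "('f::real_normed_field, 'n::finite) block_matrix"
  assume "x \<in> carrier heisenberg_group"
  then obtain v z where "x = heis v z"
    by (auto simp: carrier_heisenberg_group)
  then show "\<exists>y\<in>carrier heisenberg_group. y \<otimes>\<^bsub>heisenberg_group\<^esub> x = \<one>\<^bsub>heisenberg_group\<^esub>"
    by (intro bexI [of _ "heis (- v) (half_form v v - z)"]) (simp_all add: one_heisenberg_group)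
qed (auto simp: carrier_heisenberg_group one_heisenberg_group)

lemma inv_heisenberg_group [simp]:
  "inv\<^bsub>heisenberg_group\<^esub> (heis v z) = heis (- v) (half_form v v - z)"
  by (rule group.inv_equality [OF group_heisenberg_group])
    (simp_all add: one_heisenberg_group)

lemma group_commutator_heis:
  "group_commutator heisenberg_group (heis v z) (heis w y) = heis 0 (symplectic_form v w)"
  by (simp add: group_commutator_def half_form_diff [symmetric])

section \<open>Arithmetic of cosets modulo the central lattice\<close>

text \<open>Countability stands in for discreteness: a continuous function on an interval with
  values in a countable set is already constant.\<close>

locale additive_lattice =
  fixes L :: "'f::real_normed_field set"
  assumes one_mem: "1 \<in> L"
    and diff_mem: "\<And>x y. x \<in> L \<Longrightarrow> y \<in> L \<Longrightarrow> x - y \<in> L"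
    and countable: "countable L"
begin

lemma zero_mem: "0 \<in> L"
  using diff_mem [OF one_mem one_mem] by simp

lemma neg_mem: "x \<in> L \<Longrightarrow> - x \<in> L"
  using diff_mem [OF zero_mem] by simp

lemma add_mem: "x \<in> L \<Longrightarrow> y \<in> L \<Longrightarrow> x + y \<in> L"
  using diff_mem [OF _ neg_mem] by simp

end

lemma central_lattice_eq: "central_lattice L = heis 0 ` L"
  by (auto simp: central_lattice_def heis_def zero_vec_def)

abbreviation heis_coset ::
  "'f::real_normed_field set \<Rightarrow> 'f ^ ('n + 'n) \<Rightarrow> 'f \<Rightarrow> ('f, 'n::finite) block_matrix set" where
  "heis_coset L v z \<equiv> central_lattice L #>\<^bsub>heisenberg_group\<^esub> heis v z"

text \<open>On cosets the representative picked by \<open>lift\<close> does not matter, since the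
  lattice changes only the central coordinate.\<close>

definition coset_vector ::
  "'f::real_normed_field set \<Rightarrow> ('f, 'n) block_matrix set \<Rightarrow> 'f ^ ('n::finite + 'n)" where
  "coset_vector L c = vector_part (lift heisenberg_group (central_lattice L) c)"

context additive_lattice
begin

lemma subgroup_central_lattice: "subgroup (central_lattice L) heisenberg_group"
  by (rule group.subgroupI [OF group_heisenberg_group])
    (use zero_mem in \<open>auto simp: central_lattice_eq neg_mem add_mem\<close>)

lemma normal_central_lattice: "normal (central_lattice L) heisenberg_group"
  unfolding group.normal_inv_iff [OF group_heisenberg_group]
  by (simp add: subgroup_central_lattice)
    (auto simp: central_lattice_eq carrier_heisenberg_group)

lemma heis_coset_eq: "heis_coset L v z = {heis v y | y. y - z \<in> L}"
proof -
  have "heis_coset L v z = (\<Union>l\<in>L. {heis v (l + z)})"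
    by (simp add: r_coset_def central_lattice_eq)
  moreover have "y - z \<in> L \<longleftrightarrow> (\<exists>l\<in>L. y = l + z)" for y
    by (auto intro: bexI [of _ "y - z"])
  ultimately show ?thesis
    by auto
qed

lemma heis_coset_eq_iff: "heis_coset L v z = heis_coset L w y \<longleftrightarrow> v = w \<and> z - y \<in> L"
proof
  assume eq: "heis_coset L v z = heis_coset L w y"
  have "heis v z \<in> heis_coset L v z"
    unfolding heis_coset_eq using zero_mem by simp
  then show "v = w \<and> z - y \<in> L"
    unfolding eq unfolding heis_coset_eq by simp
next
  assume *: "v = w \<and> z - y \<in> L"
  have "x - z \<in> L \<longleftrightarrow> x - y \<in> L" for x
    using diff_mem [of "x - y" "z - y"] add_mem [of "x - z" "z - y"] * by auto
  then show "heis_coset L v z = heis_coset L w y"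
    using * unfolding heis_coset_eq by simp
qed

lemma carrier_reduced: "carrier (reduced_heisenberg_group L) = {heis_coset L v z | v z. True}"
  by (auto simp: reduced_heisenberg_group_def FactGroup_def RCOSETS_def carrier_heisenberg_group)

lemma heis_coset_in_carrier [simp]: "heis_coset L v z \<in> carrier (reduced_heisenberg_group L)"
  unfolding carrier_reduced by blast

lemma group_reduced: "group (reduced_heisenberg_group L)"
  unfolding reduced_heisenberg_group_def
  by (rule normal.factorgroup_is_group [OF normal_central_lattice])

lemma mult_reduced [simp]:
  "heis_coset L v z \<otimes>\<^bsub>reduced_heisenberg_group L\<^esub> heis_coset L w y =
     heis_coset L (v + w) (z + y + half_form v w)"
  by (simp add: reduced_heisenberg_group_def FactGroup_def
      normal.rcos_sum [OF normal_central_lattice])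

lemma commute_reduced_iff:
  "heis_coset L v z \<otimes>\<^bsub>reduced_heisenberg_group L\<^esub> heis_coset L w y =
     heis_coset L w y \<otimes>\<^bsub>reduced_heisenberg_group L\<^esub> heis_coset L v z \<longleftrightarrow>
   symplectic_form v w \<in> L"
  by (simp add: heis_coset_eq_iff add.commute half_form_diff)

lemma lift_heis_coset:
  "\<exists>y. lift heisenberg_group (central_lattice L) (heis_coset L v z) = heis v y"
proof -
  let ?x = "lift heisenberg_group (central_lattice L) (heis_coset L v z)"
  have "?x \<in> carrier heisenberg_group \<and>
      central_lattice L #>\<^bsub>heisenberg_group\<^esub> ?x = heis_coset L v z"
    unfolding lift_def by (rule someI [of _ "heis v z"]) simp
  then obtain w y where "?x = heis w y" "heis_coset L w y = heis_coset L v z"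
    by (auto simp: carrier_heisenberg_group)
  then show ?thesis
    by (auto simp: heis_coset_eq_iff)
qed

lemma coset_vector_heis_coset [simp]: "coset_vector L (heis_coset L v z) = v"
  using lift_heis_coset [of v z] by (auto simp: coset_vector_def)

lemma coset_vector_mult:
  assumes "x \<in> carrier (reduced_heisenberg_group L)" "y \<in> carrier (reduced_heisenberg_group L)"
  shows "coset_vector L (x \<otimes>\<^bsub>reduced_heisenberg_group L\<^esub> y) =
    coset_vector L x + coset_vector L y"
  using assms by (auto simp: carrier_reduced)

text \<open>\<open>coset_vector\<close> is additive with values in an abelian group; multiplying on
  the right by \<open>g\<close> turns the claim into a cancellation.\<close>

lemma coset_vector_conj:
  assumes g: "g \<in> carrier (reduced_heisenberg_group L)"
    and x: "x \<in> carrier (reduced_heisenberg_group L)"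
  shows "coset_vector L (g \<otimes>\<^bsub>reduced_heisenberg_group L\<^esub> x \<otimes>\<^bsub>reduced_heisenberg_group L\<^esub>
      inv\<^bsub>reduced_heisenberg_group L\<^esub> g) = coset_vector L x"
proof -
  interpret group "reduced_heisenberg_group L"
    by (rule group_reduced)
  have "g \<otimes>\<^bsub>reduced_heisenberg_group L\<^esub> x \<otimes>\<^bsub>reduced_heisenberg_group L\<^esub>
      inv\<^bsub>reduced_heisenberg_group L\<^esub> g \<otimes>\<^bsub>reduced_heisenberg_group L\<^esub> g =
      g \<otimes>\<^bsub>reduced_heisenberg_group L\<^esub> x"
    using g x by (simp add: m_assoc)
  then show ?thesis
    using g x by (metis coset_vector_mult add.commute add_right_cancel inv_closed m_closed)
qed

lemma group_commutator_lift:
  assumes "c \<in> carrier (reduced_heisenberg_group L)" "d \<in> carrier (reduced_heisenberg_group L)"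
  shows "group_commutator heisenberg_group
      (lift heisenberg_group (central_lattice L) c) (lift heisenberg_group (central_lattice L) d) =
    heis 0 (symplectic_form (coset_vector L c) (coset_vector L d))"
proof -
  obtain v z w y where "c = heis_coset L v z" "d = heis_coset L w y"
    using assms by (auto simp: carrier_reduced)
  then show ?thesis
    using lift_heis_coset [of v z] lift_heis_coset [of w y] by (auto simp: group_commutator_heis)
qed

text \<open>Inverses in the central subgroup agree with those in the Heisenberg group, where an
  explicit formula is available.\<close>

lemma H2_heisenberg_eq:
  "H2_heisenberg TYPE('n::finite) k L =
     {M \<in> ({..<k} \<times> {..<k}) \<rightarrow>\<^sub>E heis 0 ` L.
        \<forall>i<k. \<forall>j<k. M (j, i) = inv\<^bsub>heisenberg_group\<^esub> (M (i, j))}"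
  (is "?lhs = ?rhs")
proof -
  have inv: "inv\<^bsub>heisenberg_group\<lparr>carrier := central_lattice L\<rparr>\<^esub> x = inv\<^bsub>heisenberg_group\<^esub> x"
    if "x \<in> heis 0 ` L" for x :: "('f, 'n) block_matrix"
    using group.m_inv_consistent [OF group_heisenberg_group subgroup_central_lattice] that
    by (simp add: central_lattice_eq)
  then have "inv\<^bsub>heisenberg_group\<lparr>carrier := central_lattice L\<rparr>\<^esub> M (i, j) =
      inv\<^bsub>heisenberg_group\<^esub> M (i, j)"
    if "M \<in> ({..<k} \<times> {..<k}) \<rightarrow>\<^sub>E heis 0 ` L" "i < k" "j < k"
    for M :: "nat \<times> nat \<Rightarrow> ('f, 'n) block_matrix" and i j
    using that by (meson PiE_mem SigmaI lessThan_iff)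
  then show ?thesis
    unfolding H2_heisenberg_def Ant_def
    by (intro Collect_cong conj_cong) (simp_all add: central_lattice_eq)
qed

end


section \<open>Homomorphisms from free abelian groups\<close>

lemma (in group) commute_int_pow:
  assumes "x \<otimes> y = y \<otimes> x" "x \<in> carrier G" "y \<in> carrier G"
  shows "x [^] (n::int) \<otimes> y = y \<otimes> x [^] n"
proof -
  have inv: "inv z \<otimes> y = y \<otimes> inv z" if "z \<otimes> y = y \<otimes> z" "z \<in> carrier G" for z
  proof -
    have "z \<otimes> (y \<otimes> inv z) = (z \<otimes> y) \<otimes> inv z"
      using that(2) assms(3) by (simp add: m_assoc)
    also have "\<dots> = y"
      unfolding that(1) using that(2) assms(3) by (simp add: m_assoc)
    finally show ?thesis
      using that assms(3) by (simp add: inv_solve_left')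
  qed
  have pow: "x [^] (m::nat) \<otimes> y = y \<otimes> x [^] m" for m
    using assms by (rule group_commutes_pow)
  show ?thesis
    by (cases "n < 0")
      (simp_all only: int_pow_def2 if_True if_False pow inv [OF pow nat_pow_closed [OF assms(2)]])
qed

text \<open>An ordered product of powers, because only the entries of the tuple are going to
  commute, not the whole group.\<close>

fun tuple_power :: "'g monoid \<Rightarrow> (nat \<Rightarrow> 'g) \<Rightarrow> nat \<Rightarrow> (nat \<Rightarrow> int) \<Rightarrow> 'g" where
  "tuple_power G x 0 m = \<one>\<^bsub>G\<^esub>"
| "tuple_power G x (Suc k) m = tuple_power G x k m \<otimes>\<^bsub>G\<^esub> (x k [^]\<^bsub>G\<^esub> m k)"

locale commuting_tuple = group G for G :: "'g monoid" (structure) +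
  fixes x :: "nat \<Rightarrow> 'g" and k :: nat
  assumes closed: "i < k \<Longrightarrow> x i \<in> carrier G"
    and commute: "i < k \<Longrightarrow> j < k \<Longrightarrow> x i \<otimes> x j = x j \<otimes> x i"
begin

lemma tuple_power_closed: "r \<le> k \<Longrightarrow> tuple_power G x r m \<in> carrier G"
  by (induction r) (simp_all add: closed)

lemma tuple_power_cong:
  "(\<And>i. i < r \<Longrightarrow> m i = m' i) \<Longrightarrow> tuple_power G x r m = tuple_power G x r m'"
  by (induction r) simp_all

lemma tuple_power_commute:
  assumes "i < k" "r \<le> k"
  shows "x i [^] (n::int) \<otimes> tuple_power G x r m = tuple_power G x r m \<otimes> x i [^] n"
  using assms(2)
proof (induction r)
  case 0
  then show ?case
    using assms(1) by (simp add: closed)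
next
  case (Suc r)
  let ?P = "tuple_power G x r m" and ?a = "x i [^] n" and ?b = "x r [^] m r"
  have mem: "?P \<in> carrier G" "?a \<in> carrier G" "?b \<in> carrier G"
    using Suc.prems assms(1) by (simp_all add: tuple_power_closed closed)
  \<comment> \<open>\<open>commute_int_pow\<close> raises only one factor to a power, so it is
    applied once for each factor.\<close>
  have "x r \<otimes> ?a = ?a \<otimes> x r"
    using commute_int_pow [of "x i" "x r" n] Suc.prems assms(1) by (simp add: closed commute)
  then have ab: "?b \<otimes> ?a = ?a \<otimes> ?b"
    using commute_int_pow [of "x r" ?a "m r"] Suc.prems mem by (simp add: closed)
  have "?a \<otimes> (?P \<otimes> ?b) = (?a \<otimes> ?P) \<otimes> ?b"
    using mem by (simp add: m_assoc)
  also have "\<dots> = ?P \<otimes> (?a \<otimes> ?b)"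
    using Suc.IH Suc.prems mem by (simp add: m_assoc)
  also have "\<dots> = (?P \<otimes> ?b) \<otimes> ?a"
    using mem ab by (simp add: m_assoc)
  finally show ?case
    by simp
qed

lemma tuple_power_add:
  "r \<le> k \<Longrightarrow> tuple_power G x r (\<lambda>i. m i + m' i) = tuple_power G x r m \<otimes> tuple_power G x r m'"
proof (induction r)
  case (Suc r)
  let ?P = "tuple_power G x r m" and ?P' = "tuple_power G x r m'"
  let ?a = "x r [^] m r" and ?a' = "x r [^] m' r"
  have mem: "?P \<in> carrier G" "?P' \<in> carrier G" "?a \<in> carrier G" "?a' \<in> carrier G"
    using Suc.prems by (simp_all add: tuple_power_closed closed)
  have "tuple_power G x (Suc r) (\<lambda>i. m i + m' i) = (?P \<otimes> ?P') \<otimes> (?a \<otimes> ?a')"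
    using Suc by (simp add: int_pow_mult closed)
  also have "\<dots> = ?P \<otimes> ((?P' \<otimes> ?a) \<otimes> ?a')"
    using mem by (simp add: m_assoc)
  also have "\<dots> = ?P \<otimes> ((?a \<otimes> ?P') \<otimes> ?a')"
    using tuple_power_commute [of r r "m r" m'] Suc.prems by simp
  also have "\<dots> = (?P \<otimes> ?a) \<otimes> (?P' \<otimes> ?a')"
    using mem by (simp add: m_assoc)
  finally show ?case
    by simp
qed simp

lemma tuple_power_unit:
  assumes "r \<le> k"
  shows "tuple_power G x r (unit_tuple k i) = (if i < r then x i else \<one>)"
  using assms
proof (induction r)
  case (Suc r)
  then show ?case
    by (auto simp: unit_tuple_def closed int_pow_1 less_Suc_eq)
qed simp

text \<open>The universal property of the free abelian group on \<open>k\<close> generators, with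
  \<open>tuple_power\<close> as the extension.\<close>

lemma Hom_set_extension: "\<exists>\<rho>\<in>Hom_set k G. \<forall>i<k. \<rho> (unit_tuple k i) = x i"
proof
  let ?\<rho> = "\<lambda>m\<in>carrier (Zpow k). tuple_power G x k m"
  \<comment> \<open>Addition in \<open>Zpow k\<close> restricts to indices below \<open>k\<close>,
    whereas \<open>tuple_power_add\<close> uses the plain pointwise sum; \<open>tuple_power\<close>
    does not see the difference.\<close>
  have "tuple_power G x k (\<lambda>i\<in>{..<k}. m i + m' i) = tuple_power G x k m \<otimes> tuple_power G x k m'"
    for m m'
    using tuple_power_cong [of k "\<lambda>i\<in>{..<k}. m i + m' i" "\<lambda>i. m i + m' i"] tuple_power_add [of k]
    by simp
  then show "?\<rho> \<in> Hom_set k G"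
    by (auto simp: Hom_set_def hom_def tuple_power_closed)
  show "\<forall>i<k. ?\<rho> (unit_tuple k i) = x i"
    by (simp add: tuple_power_unit) (simp add: unit_tuple_def)
qed

end

section \<open>Topology and paths in spaces of homomorphisms\<close>

lemma topspace_Hom_space:
  assumes "topspace X = carrier G"
  shows "topspace (Hom_space k G X) = Hom_set k G"
proof -
  have "(\<lambda>i\<in>{..<k}. \<rho> (unit_tuple k i)) \<in> ({..<k} \<rightarrow>\<^sub>E carrier G)" if "\<rho> \<in> Hom_set k G" for \<rho>
    using that by (auto simp: Hom_set_def hom_def unit_tuple_def Pi_iff)
  then show ?thesis
    using assms by (auto simp: Hom_space_def topspace_pullback_topology topspace_product_topology)
qed

text \<open>
  Homomorphisms with the same values on the basis are topologically indistinguishable, so the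
  homomorphisms interpolating between the two ends may be chosen arbitrarily.
\<close>

lemma Hom_space_pathI:
  fixes \<gamma> :: "real \<Rightarrow> nat \<Rightarrow> 'g"
  assumes G: "group G" and X: "topspace X = carrier G"
    and cont: "\<And>i. i < k \<Longrightarrow> continuous_map (top_of_set {0..1}) X (\<lambda>t. \<gamma> t i)"
    and commute: "\<And>t i j. t \<in> {0..1} \<Longrightarrow> i < k \<Longrightarrow> j < k \<Longrightarrow> \<gamma> t i \<otimes>\<^bsub>G\<^esub> \<gamma> t j = \<gamma> t j \<otimes>\<^bsub>G\<^esub> \<gamma> t i"
    and \<rho>: "\<rho> \<in> Hom_set k G" "\<And>i. i < k \<Longrightarrow> \<rho> (unit_tuple k i) = \<gamma> 0 i"
    and \<rho>': "\<rho>' \<in> Hom_set k G" "\<And>i. i < k \<Longrightarrow> \<rho>' (unit_tuple k i) = \<gamma> 1 i"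
  shows "path_component_of (Hom_space k G X) \<rho> \<rho>'"
proof -
  have closed: "\<gamma> t i \<in> carrier G" if "t \<in> {0..1}" "i < k" for t i
    using continuous_map_funspace [OF cont [OF that(2)]] that(1) X by auto
  have "\<exists>\<sigma>\<in>Hom_set k G. \<forall>i<k. \<sigma> (unit_tuple k i) = \<gamma> t i" if "t \<in> {0..1}" for t
  proof -
    interpret group G
      by (rule G)
    interpret commuting_tuple G "\<gamma> t" k
      by unfold_locales (use closed commute that in auto)
    show ?thesis
      by (rule Hom_set_extension)
  qed
  then obtain h where h: "\<And>t. t \<in> {0..1} \<Longrightarrow> h t \<in> Hom_set k G"
    "\<And>t i. t \<in> {0..1} \<Longrightarrow> i < k \<Longrightarrow> h t (unit_tuple k i) = \<gamma> t i"
    by metis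
  define g where "g t = (if t = 0 then \<rho> else if t = 1 then \<rho>' else h t)" for t :: real
  have g: "g t \<in> Hom_set k G" "\<And>i. i < k \<Longrightarrow> g t (unit_tuple k i) = \<gamma> t i" if "t \<in> {0..1}" for t
    using \<rho> \<rho>' h that by (simp_all add: g_def)
  have "continuous_map (top_of_set {0..1}) (product_topology (\<lambda>_. X) {..<k})
      (\<lambda>t. \<lambda>i\<in>{..<k}. \<gamma> t i)"
    using cont by (auto simp: continuous_map_componentwise)
  then have "continuous_map (top_of_set {0..1}) (product_topology (\<lambda>_. X) {..<k})
      ((\<lambda>\<rho>. \<lambda>i\<in>{..<k}. \<rho> (unit_tuple k i)) \<circ> g)"
    by (rule continuous_map_eq) (use g in \<open>auto simp: fun_eq_iff\<close>)
  then have "pathin (Hom_space k G X) g"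
    unfolding pathin_def Hom_space_def
    by (rule continuous_map_pullback') (use g in auto)
  then show ?thesis
    unfolding path_component_of_def by (intro exI [of _ g]) (simp add: g_def)
qed

lemma quotient_map_rep_class: "quotient_map (Hom_space k G X) (Rep_space k G X) (rep_class k G)"
  unfolding Rep_space_def by (rule quotient_map_quotient_topology)

lemma continuous_map_Hom_space_eval:
  assumes "i < k"
  shows "continuous_map (Hom_space k G X) X (\<lambda>\<rho>. \<rho> (unit_tuple k i))"
proof -
  have "continuous_map (Hom_space k G X) X
      ((\<lambda>x. x i) \<circ> (\<lambda>\<rho>. \<lambda>i\<in>{..<k}. \<rho> (unit_tuple k i)))"
    unfolding Hom_space_def
    by (rule continuous_map_pullback) (use assms in \<open>auto intro: continuous_map_product_projection\<close>)
  then show ?thesis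
    using assms by (simp add: o_def)
qed

text \<open>The function descends to the quotient, so the path need not be lifted to
  \<open>X\<close>. Along the path its values form a connected countable set in a metric space,
  which has at most one point.\<close>

lemma path_component_of_discrete_invariant:
  fixes f :: "'a \<Rightarrow> 'b::metric_space"
  assumes q: "quotient_map X Y q" and f: "continuous_map X euclidean f"
    and compat: "\<And>x y. x \<in> topspace X \<Longrightarrow> y \<in> topspace X \<Longrightarrow> q x = q y \<Longrightarrow> f x = f y"
    and countable: "countable (f ` topspace X)"
    and path: "path_component_of Y (q x) (q y)" and "x \<in> topspace X" "y \<in> topspace X"
  shows "f x = f y"
proof -
  obtain g where g: "continuous_map Y euclidean g" "g ` topspace Y = f ` topspace X"
    "\<And>x. x \<in> topspace X \<Longrightarrow> g (q x) = f x"
    using quotient_map_lift_exists [OF q f] compat by metis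
  obtain p where p: "pathin Y p" "p 0 = q x" "p 1 = q y"
    using path unfolding path_component_of_def by blast
  have "continuous_on {0..1} (g \<circ> p)"
    using continuous_map_compose [OF p(1) [unfolded pathin_def] g(1)]
    by (simp only: continuous_map_iff_continuous)
  then have "connected ((g \<circ> p) ` {0..1})"
    using connected_continuous_image connected_Icc by blast
  moreover have "(g \<circ> p) ` {0..1} \<subseteq> f ` topspace X"
    using continuous_map_image_subset_topspace [OF p(1) [unfolded pathin_def]] g(2) by auto
  ultimately have "(g \<circ> p) 0 = (g \<circ> p) 1"
    using connected_uncountable [of "(g \<circ> p) ` {0..1}" "(g \<circ> p) 0" "(g \<circ> p) 1"]
      countable_subset [OF _ countable] by fastforce
  then show ?thesis
    using p g(3) assms(6,7) by simp
qed


section \<open>Path components of the representation space\<close>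

lemma continuous_on_heis:
  fixes f :: "'a::topological_space \<Rightarrow> 'f::real_normed_field ^ ('n::finite + 'n)"
  assumes "continuous_on S f" "continuous_on S c"
  shows "continuous_on S (\<lambda>x. heis (f x) (c x))"
  unfolding heis_def heisenberg_matrix_def
proof (intro continuous_on_vec_lambda)
  fix r s :: "'n block_index"
  show "continuous_on S (\<lambda>x. heisenberg_entry (\<chi> i. f x $ Inl i) (\<chi> i. f x $ Inr i) (c x) r s)"
    using assms by (cases r; cases s) (auto intro!: continuous_intros)
qed

lemma continuous_on_vector_part:
  fixes S :: "('f::real_normed_field, 'n::finite) block_matrix set"
  shows "continuous_on S vector_part"
  unfolding vector_part_def
proof (rule continuous_on_vec_lambda)
  show "continuous_on S (\<lambda>m. case s of Inl i \<Rightarrow> m $ First $ Mid i | Inr i \<Rightarrow> m $ Mid i $ Last)"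
    for s :: "'n + 'n"
    by (cases s) (auto intro!: continuous_intros)
qed

lemma unit_tuple_in_carrier: "unit_tuple k i \<in> carrier (Zpow k)"
  by (simp add: unit_tuple_def)

lemma Hom_set_eval_closed: "\<rho> \<in> Hom_set k G \<Longrightarrow> \<rho> (unit_tuple k i) \<in> carrier G"
  using unit_tuple_in_carrier [of k i] by (auto simp: Hom_set_def dest: hom_in_carrier)

lemma Hom_set_eval_commute:
  assumes "\<rho> \<in> Hom_set k G"
  shows "\<rho> (unit_tuple k i) \<otimes>\<^bsub>G\<^esub> \<rho> (unit_tuple k j) = \<rho> (unit_tuple k j) \<otimes>\<^bsub>G\<^esub> \<rho> (unit_tuple k i)"
proof -
  have \<rho>: "\<rho> \<in> hom (Zpow k) G"
    using assms by (simp add: Hom_set_def)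
  have "unit_tuple k i \<otimes>\<^bsub>Zpow k\<^esub> unit_tuple k j = unit_tuple k j \<otimes>\<^bsub>Zpow k\<^esub> unit_tuple k i"
    by (simp add: add.commute)
  then show ?thesis
    using hom_mult [OF \<rho>] unit_tuple_in_carrier by metis
qed

lemma conj_action_one:
  assumes "group G" "\<rho> \<in> Hom_set k G"
  shows "conj_action k G \<one>\<^bsub>G\<^esub> \<rho> = \<rho>"
proof -
  interpret group G
    by (rule assms)
  have "\<rho> v \<in> carrier G" if "v \<in> carrier (Zpow k)" for v
    using assms(2) that by (auto simp: Hom_set_def dest: hom_in_carrier)
  then show ?thesis
    using assms(2) unfolding conj_action_def Hom_set_def
    by (intro extensionalityI [of _ "carrier (Zpow k)"]) auto
qed

text \<open>\<open>\<rho>\<close> lies in its own orbit through the identity element, hence in the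
  orbit of \<open>\<rho>'\<close>.\<close>

lemma rep_class_eqD:
  assumes "group G" "\<rho> \<in> Hom_set k G" "rep_class k G \<rho> = rep_class k G \<rho>'"
  shows "\<exists>g\<in>carrier G. \<rho> = conj_action k G g \<rho>'"
proof -
  interpret group G
    by (rule assms)
  have "conj_action k G \<one>\<^bsub>G\<^esub> \<rho> \<in> rep_class k G \<rho>"
    unfolding rep_class_def orbit_def by blast
  then have "\<rho> \<in> rep_class k G \<rho>'"
    using assms by (simp add: conj_action_one)
  then show ?thesis
    unfolding rep_class_def orbit_def by blast
qed

definition hom_gram ::
  "nat \<Rightarrow> 'f::real_normed_field set \<Rightarrow> ((nat \<Rightarrow> int) \<Rightarrow> ('f, 'n::finite) block_matrix set) \<Rightarrow>
     nat \<Rightarrow> nat \<Rightarrow> 'f" where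
  "hom_gram k L \<rho> i j =
     symplectic_form (coset_vector L (\<rho> (unit_tuple k i))) (coset_vector L (\<rho> (unit_tuple k j)))"

context additive_lattice
begin

lemma quotient_map_heis_coset:
  "quotient_map heisenberg_topology (reduced_heisenberg_topology L)
     (\<lambda>x. central_lattice L #>\<^bsub>heisenberg_group\<^esub> x)"
  unfolding reduced_heisenberg_topology_def by (rule quotient_map_quotient_topology)

lemma topspace_reduced: "topspace (reduced_heisenberg_topology L) = carrier (reduced_heisenberg_group L)"
  unfolding reduced_heisenberg_topology_def topspace_quotient_topology heisenberg_topology_def
    carrier_reduced by (auto simp: carrier_heisenberg_group)

lemma continuous_map_coset_vector:
  "continuous_map (reduced_heisenberg_topology L) euclidean (coset_vector L)"
proof (rule continuous_compose_quotient_map [OF quotient_map_heis_coset])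
  have "continuous_map heisenberg_topology euclidean vector_part"
    unfolding heisenberg_topology_def by (simp add: continuous_on_vector_part)
  then show "continuous_map heisenberg_topology euclidean
      (coset_vector L \<circ> (\<lambda>x. central_lattice L #>\<^bsub>heisenberg_group\<^esub> x))"
    by (rule continuous_map_eq) (auto simp: heisenberg_topology_def carrier_heisenberg_group)
qed

lemma continuous_map_heis_coset:
  assumes "continuous_on S f" "continuous_on S c"
  shows "continuous_map (top_of_set S) (reduced_heisenberg_topology L) (\<lambda>x. heis_coset L (f x) (c x))"
proof -
  have "continuous_map (top_of_set S) heisenberg_topology (\<lambda>x. heis (f x) (c x))"
    unfolding heisenberg_topology_def
    using continuous_on_heis [OF assms] by (auto simp: continuous_map_in_subtopology)
  from continuous_map_compose [OF this quotient_imp_continuous_map [OF quotient_map_heis_coset]]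
  show ?thesis
    by (simp add: o_def)
qed

lemma commutator_matrix_eq:
  assumes "\<rho> \<in> Hom_set k (reduced_heisenberg_group L)"
  shows "commutator_matrix k heisenberg_group (central_lattice L) \<rho> =
    (\<lambda>(i, j)\<in>{..<k} \<times> {..<k}. heis 0 (hom_gram k L \<rho> i j))"
  unfolding commutator_matrix_def hom_gram_def
  using group_commutator_lift [OF Hom_set_eval_closed Hom_set_eval_closed, OF assms assms]
  by (intro restrict_ext) auto

lemma commutator_matrix_eq_iff:
  assumes "\<rho> \<in> Hom_set k (reduced_heisenberg_group L)" "\<rho>' \<in> Hom_set k (reduced_heisenberg_group L)"
  shows "commutator_matrix k heisenberg_group (central_lattice L) \<rho> =
      commutator_matrix k heisenberg_group (central_lattice L) \<rho>' \<longleftrightarrow>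
    (\<forall>i<k. \<forall>j<k. hom_gram k L \<rho> i j = hom_gram k L \<rho>' i j)"
  unfolding commutator_matrix_eq [OF assms(1)] commutator_matrix_eq [OF assms(2)]
  by (auto simp: fun_eq_iff restrict_def)

text \<open>The images of two basis vectors commute in the quotient, which says exactly that the
  form of their vectors lies in \<open>L\<close>.\<close>

lemma hom_gram_mem:
  assumes "\<rho> \<in> Hom_set k (reduced_heisenberg_group L)"
  shows "hom_gram k L \<rho> i j \<in> L"
proof -
  obtain v z w y where *: "\<rho> (unit_tuple k i) = heis_coset L v z" "\<rho> (unit_tuple k j) = heis_coset L w y"
    using Hom_set_eval_closed [OF assms, of i] Hom_set_eval_closed [OF assms, of j]
    by (auto simp: carrier_reduced)
  then show ?thesis
    using Hom_set_eval_commute [OF assms, of i j] unfolding hom_gram_def * commute_reduced_iff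
    by (simp only: coset_vector_heis_coset)
qed

lemma hom_gram_conj:
  assumes "\<rho> \<in> Hom_set k (reduced_heisenberg_group L)" "g \<in> carrier (reduced_heisenberg_group L)"
  shows "hom_gram k L (conj_action k (reduced_heisenberg_group L) g \<rho>) i j = hom_gram k L \<rho> i j"
  using coset_vector_conj [OF assms(2) Hom_set_eval_closed [OF assms(1)]] unit_tuple_in_carrier
  unfolding hom_gram_def conj_action_def by (simp only: restrict_apply' if_True)

lemma topspace_Hom_reduced:
  "topspace (Hom_space k (reduced_heisenberg_group L) (reduced_heisenberg_topology L)) =
     Hom_set k (reduced_heisenberg_group L)"
  by (rule topspace_Hom_space [OF topspace_reduced])

lemma continuous_map_hom_gram:
  assumes "i < k" "j < k"
  shows "continuous_map (Hom_space k (reduced_heisenberg_group L) (reduced_heisenberg_topology L))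
    euclidean (\<lambda>\<rho>. hom_gram k L (\<rho> :: _ \<Rightarrow> ('f, 'n::finite) block_matrix set) i j)"
proof -
  let ?X = "Hom_space k (reduced_heisenberg_group L) (reduced_heisenberg_topology L)
    :: (_ \<Rightarrow> ('f, 'n) block_matrix set) topology"
  have cv: "continuous_map ?X euclidean (\<lambda>\<rho>. coset_vector L (\<rho> (unit_tuple k i)))" if "i < k" for i
    using continuous_map_compose [OF continuous_map_Hom_space_eval [OF that] continuous_map_coset_vector]
    by (simp add: o_def)
  have form: "continuous_map euclidean euclidean
      (\<lambda>p. symplectic_form (fst p) (snd p :: 'f ^ ('n + 'n)))"
    by (simp add: continuous_intros)
  have "continuous_map ?X euclidean
      (\<lambda>\<rho>. (coset_vector L (\<rho> (unit_tuple k i)), coset_vector L (\<rho> (unit_tuple k j))))"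
    using continuous_map_pairedI [OF cv [OF assms(1)] cv [OF assms(2)]] by simp
  from continuous_map_compose [OF this form] show ?thesis
    unfolding hom_gram_def by (simp add: o_def)
qed

text \<open>Each Gram entry is continuous, conjugation invariant and has values in the countable set
  \<open>L\<close>, so it cannot vary along a path of orbits.\<close>

lemma path_component_of_Rep_gram:
  assumes \<rho>: "\<rho> \<in> Hom_set k (reduced_heisenberg_group L)" "\<rho>' \<in> Hom_set k (reduced_heisenberg_group L)"
    and path: "path_component_of (Rep_space k (reduced_heisenberg_group L) (reduced_heisenberg_topology L))
      (rep_class k (reduced_heisenberg_group L) \<rho>) (rep_class k (reduced_heisenberg_group L) \<rho>')"
    and "i < k" "j < k"
  shows "hom_gram k L \<rho> i j = hom_gram k L \<rho>' i j"
proof (rule path_component_of_discrete_invariant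
    [where f = "\<lambda>\<rho>. hom_gram k L \<rho> i j" and q = "rep_class k (reduced_heisenberg_group L)",
      OF quotient_map_rep_class continuous_map_hom_gram [OF assms(4,5)] _ _ path])
  show "hom_gram k L \<sigma> i j = hom_gram k L \<tau> i j"
    if mem: "\<sigma> \<in> topspace (Hom_space k (reduced_heisenberg_group L) (reduced_heisenberg_topology L))"
        "\<tau> \<in> topspace (Hom_space k (reduced_heisenberg_group L) (reduced_heisenberg_topology L))"
      and eq: "rep_class k (reduced_heisenberg_group L) \<sigma> = rep_class k (reduced_heisenberg_group L) \<tau>"
    for \<sigma> \<tau>
  proof -
    obtain g where "g \<in> carrier (reduced_heisenberg_group L)"
      "\<sigma> = conj_action k (reduced_heisenberg_group L) g \<tau>"
      using rep_class_eqD [OF group_reduced _ eq] mem unfolding topspace_Hom_reduced by metis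
    then show ?thesis
      using mem unfolding topspace_Hom_reduced by (simp only: hom_gram_conj)
  qed
  show "countable ((\<lambda>\<rho>. hom_gram k L \<rho> i j) `
      topspace (Hom_space k (reduced_heisenberg_group L) (reduced_heisenberg_topology L)))"
    using hom_gram_mem unfolding topspace_Hom_reduced
    by (intro countable_subset [OF _ countable]) auto
qed (use \<rho> in \<open>simp_all only: topspace_Hom_reduced\<close>)

text \<open>The vectors move inside a path-connected Gram fibre. Commutation modulo \<open>L\<close>
  depends on the vectors alone, so the central coordinates can move freely.\<close>

lemma path_component_of_Hom_reduced:
  fixes \<rho> \<rho>' :: "(nat \<Rightarrow> int) \<Rightarrow> ('f, 'n::finite) block_matrix set"
  assumes \<rho>: "\<rho> \<in> Hom_set k (reduced_heisenberg_group L)" "\<rho>' \<in> Hom_set k (reduced_heisenberg_group L)"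
    and gram: "\<And>i j. i < k \<Longrightarrow> j < k \<Longrightarrow> hom_gram k L \<rho> i j = hom_gram k L \<rho>' i j"
  shows "path_component_of (Hom_space k (reduced_heisenberg_group L) (reduced_heisenberg_topology L)) \<rho> \<rho>'"
proof -
  have "\<exists>z. \<sigma> (unit_tuple k i) = heis_coset L (coset_vector L (\<sigma> (unit_tuple k i))) z"
    if "\<sigma> \<in> Hom_set k (reduced_heisenberg_group L)" for i
      and \<sigma> :: "(nat \<Rightarrow> int) \<Rightarrow> ('f, 'n) block_matrix set"
    using Hom_set_eval_closed [OF that, of i] by (auto simp: carrier_reduced)
  then obtain z y where
    z: "\<And>i. \<rho> (unit_tuple k i) = heis_coset L (coset_vector L (\<rho> (unit_tuple k i))) (z i)" and
    y: "\<And>i. \<rho>' (unit_tuple k i) = heis_coset L (coset_vector L (\<rho>' (unit_tuple k i))) (y i)"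
    using \<rho> by metis
  let ?v = "\<lambda>i. coset_vector L (\<rho> (unit_tuple k i))" and ?w = "\<lambda>i. coset_vector L (\<rho>' (unit_tuple k i))"
  let ?F = "gram_fibre {..<k} (hom_gram k L \<rho>) :: (nat \<Rightarrow> 'f ^ ('n + 'n)) set"
  have "?v \<in> ?F" "?w \<in> ?F"
    using gram by (simp_all add: gram_fibre_def hom_gram_def)
  moreover have "path_connected ?F"
    by (rule path_connected_gram_fibre) simp
  ultimately have "path_component ?F ?v ?w"
    by (simp add: path_connected_component)
  then obtain p where "path p" "path_image p \<subseteq> ?F" "pathstart p = ?v" "pathfinish p = ?w"
    unfolding path_component_def by (elim exE conjE)
  then have p: "continuous_on {0..1} p" "p ` {0..1} \<subseteq> ?F" "p 0 = ?v" "p 1 = ?w"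
    by (simp_all add: path_def path_image_def pathstart_def pathfinish_def)
  show ?thesis
  proof (rule Hom_space_pathI [OF group_reduced topspace_reduced _ _ \<rho>(1) _ \<rho>(2)])
    \<comment> \<open>Arbitrary representatives \<open>z i\<close> and \<open>y i\<close> of the
      central coordinates are joined by a straight segment.\<close>
    let ?\<gamma> = "\<lambda>t i. heis_coset L (p t i) (of_real (1 - t) * z i + of_real t * y i)"
    show "continuous_map (top_of_set {0..1}) (reduced_heisenberg_topology L) (\<lambda>t. ?\<gamma> t i)" for i
      using continuous_on_product_then_coordinatewise [OF p(1)]
      by (intro continuous_map_heis_coset continuous_intros)
    show "?\<gamma> t i \<otimes>\<^bsub>reduced_heisenberg_group L\<^esub> ?\<gamma> t j =
        ?\<gamma> t j \<otimes>\<^bsub>reduced_heisenberg_group L\<^esub> ?\<gamma> t i" if "t \<in> {0..1}" "i < k" "j < k" for t i j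
      unfolding commute_reduced_iff
      using subsetD [OF p(2) imageI [OF that(1)]] that(2,3) hom_gram_mem [OF \<rho>(1), of i j]
      by (simp add: gram_fibre_def)
    show "\<rho> (unit_tuple k i) = ?\<gamma> 0 i" for i
      using z [of i] p(3) by simp
    show "\<rho>' (unit_tuple k i) = ?\<gamma> 1 i" for i
      using y [of i] p(4) by simp
  qed
qed

text \<open>Paths of orbits preserve the Gram entries; conversely, equal entries give a path of
  homomorphisms, which projects to the orbit space.\<close>

lemma path_component_of_Rep_iff:
  assumes "\<rho> \<in> Hom_set k (reduced_heisenberg_group L)" "\<rho>' \<in> Hom_set k (reduced_heisenberg_group L)"
  shows "path_component_of (Rep_space k (reduced_heisenberg_group L) (reduced_heisenberg_topology L))
      (rep_class k (reduced_heisenberg_group L) \<rho>) (rep_class k (reduced_heisenberg_group L) \<rho>') \<longleftrightarrow>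
    commutator_matrix k heisenberg_group (central_lattice L) \<rho> =
      commutator_matrix k heisenberg_group (central_lattice L) \<rho>'"
  unfolding commutator_matrix_eq_iff [OF assms]
  using path_component_of_Rep_gram [OF assms] path_component_of_Hom_reduced [OF assms]
    path_component_of_continuous_image [OF quotient_imp_continuous_map [OF quotient_map_rep_class]]
  by metis

lemma topspace_Rep_reduced:
  "topspace (Rep_space k (reduced_heisenberg_group L) (reduced_heisenberg_topology L)) =
     rep_class k (reduced_heisenberg_group L) ` Hom_set k (reduced_heisenberg_group L)"
  unfolding Rep_space_def topspace_quotient_topology topspace_Hom_reduced ..

definition rep_component ::
  "nat \<Rightarrow> ((nat \<Rightarrow> int) \<Rightarrow> ('f, 'n::finite) block_matrix set) \<Rightarrow>
     ((nat \<Rightarrow> int) \<Rightarrow> ('f, 'n) block_matrix set) set set" where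
  "rep_component k \<rho> =
     path_component_of_set (Rep_space k (reduced_heisenberg_group L) (reduced_heisenberg_topology L))
       (rep_class k (reduced_heisenberg_group L) \<rho>)"

lemma pi0_Rep_eq:
  "pi0_Rep TYPE('n::finite) k L =
     rep_component k ` Hom_set k (reduced_heisenberg_group L :: ('f, 'n) block_matrix set monoid)"
  unfolding pi0_Rep_def path_components_of_def topspace_Rep_reduced image_image rep_component_def ..

text \<open>The definite description is satisfied because commutator matrices are constant on the
  component, and it is unique because \<open>\<rho>\<close> itself represents a point there.\<close>

lemma forget_flat_rep_component:
  fixes \<rho> :: "(nat \<Rightarrow> int) \<Rightarrow> ('f, 'n::finite) block_matrix set"
  assumes \<rho>: "\<rho> \<in> Hom_set k (reduced_heisenberg_group L)"
  shows "forget_flat_heisenberg TYPE('n) k L (rep_component k \<rho>) =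
    commutator_matrix k heisenberg_group (central_lattice L) \<rho>"
  unfolding forget_flat_heisenberg_def forget_flat_def
proof (rule the_equality; unfold reduced_heisenberg_group_def [symmetric])
  show "\<forall>\<sigma>\<in>Hom_set k (reduced_heisenberg_group L).
      rep_class k (reduced_heisenberg_group L) \<sigma> \<in> rep_component k \<rho> \<longrightarrow>
      commutator_matrix k heisenberg_group (central_lattice L) \<sigma> =
        commutator_matrix k heisenberg_group (central_lattice L) \<rho>"
    unfolding rep_component_def using path_component_of_Rep_iff [OF \<rho>] by simp
  fix M
  assume "\<forall>\<sigma>\<in>Hom_set k (reduced_heisenberg_group L).
      rep_class k (reduced_heisenberg_group L) \<sigma> \<in> rep_component k \<rho> \<longrightarrow>
      commutator_matrix k heisenberg_group (central_lattice L) \<sigma> = M"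
  moreover have "rep_class k (reduced_heisenberg_group L) \<rho> \<in> rep_component k \<rho>"
    unfolding rep_component_def using path_component_of_Rep_iff [OF \<rho> \<rho>] by simp
  ultimately show "M = commutator_matrix k heisenberg_group (central_lattice L) \<rho>"
    using \<rho> by metis
qed

lemma rep_component_eq:
  assumes "\<rho> \<in> Hom_set k (reduced_heisenberg_group L)" "\<rho>' \<in> Hom_set k (reduced_heisenberg_group L)"
    and "commutator_matrix k heisenberg_group (central_lattice L) \<rho> =
      commutator_matrix k heisenberg_group (central_lattice L) \<rho>'"
  shows "rep_component k \<rho> = rep_component k \<rho>'"
  unfolding rep_component_def
  using path_component_of_Rep_iff [OF assms(1,2)] assms(3) path_component_of_equiv by metis

end


section \<open>The image of the forgetful map\<close>

context additive_lattice
begin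

lemma H2_heisenbergI:
  assumes "\<And>i j. N i j \<in> L" and anti: "\<And>i j. N j i = - N i j"
  shows "(\<lambda>(i, j)\<in>{..<k} \<times> {..<k}. heis 0 (N i j)) \<in> H2_heisenberg TYPE('n::finite) k L"
proof -
  let ?M = "\<lambda>(i, j)\<in>{..<k} \<times> {..<k}. heis 0 (N i j) :: ('f, 'n) block_matrix"
  have "?M (j, i) = inv\<^bsub>heisenberg_group\<^esub> (?M (i, j))" if "i < k" "j < k" for i j
    using that by (subst anti) simp
  moreover have "?M \<in> ({..<k} \<times> {..<k}) \<rightarrow>\<^sub>E heis 0 ` L"
    using assms(1) by auto
  ultimately show ?thesis
    unfolding H2_heisenberg_eq by blast
qed

lemma commutator_matrix_mem_H2:
  fixes \<rho> :: "(nat \<Rightarrow> int) \<Rightarrow> ('f, 'n::finite) block_matrix set"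
  assumes "\<rho> \<in> Hom_set k (reduced_heisenberg_group L)"
  shows "commutator_matrix k heisenberg_group (central_lattice L) \<rho> \<in> H2_heisenberg TYPE('n) k L"
  unfolding commutator_matrix_eq [OF assms]
proof (rule H2_heisenbergI)
  show "hom_gram k L \<rho> j i = - hom_gram k L \<rho> i j" for i j
    unfolding hom_gram_def by (rule symplectic_form_swap)
qed (rule hom_gram_mem [OF assms])

text \<open>Any central coordinates would do; with all of them 0, the cosets commute because the
  Gram entries lie in \<open>L\<close>.\<close>

lemma exists_hom_of_gram:
  fixes v :: "nat \<Rightarrow> 'f ^ ('n::finite + 'n)"
  assumes v: "v \<in> gram_fibre {..<k} N" and N: "\<And>i j. i < k \<Longrightarrow> j < k \<Longrightarrow> N i j \<in> L"
  shows "\<exists>\<rho>\<in>Hom_set k (reduced_heisenberg_group L :: ('f, 'n) block_matrix set monoid).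
    \<forall>i<k. \<forall>j<k. hom_gram k L \<rho> i j = N i j"
proof -
  let ?x = "\<lambda>i. heis_coset L (v i) 0"
  have form: "symplectic_form (v i) (v j) = N i j" if "i < k" "j < k" for i j
    using v that by (simp add: gram_fibre_def)
  interpret group "reduced_heisenberg_group L :: ('f, 'n) block_matrix set monoid"
    by (rule group_reduced)
  interpret commuting_tuple "reduced_heisenberg_group L" ?x k
  proof
    show "?x i \<otimes>\<^bsub>reduced_heisenberg_group L\<^esub> ?x j = ?x j \<otimes>\<^bsub>reduced_heisenberg_group L\<^esub> ?x i"
      if "i < k" "j < k" for i j
      unfolding commute_reduced_iff form [OF that] by (rule N [OF that])
  qed simp
  obtain \<rho> where "\<rho> \<in> Hom_set k (reduced_heisenberg_group L)"
      "\<And>i. i < k \<Longrightarrow> \<rho> (unit_tuple k i) = ?x i"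
    using Hom_set_extension by metis
  then show ?thesis
    using form by (intro bexI [of _ \<rho>]) (simp_all add: hom_gram_def)
qed

lemma H2_realizable:
  assumes k: "k div 2 \<le> CARD('n::finite)" and M: "M \<in> H2_heisenberg TYPE('n) k L"
  shows "\<exists>\<rho>\<in>Hom_set k (reduced_heisenberg_group L :: ('f, 'n) block_matrix set monoid).
    commutator_matrix k heisenberg_group (central_lattice L) \<rho> = M"
proof -
  \<comment> \<open>The corner entry is the central coordinate, so \<open>N\<close> is the scalar
    matrix encoded by \<open>M\<close>.\<close>
  define N where "N i j = M (i, j) $ First $ Last" for i j
  have ext: "M \<in> ({..<k} \<times> {..<k}) \<rightarrow>\<^sub>E heis 0 ` L"
    and inv: "\<And>i j. i < k \<Longrightarrow> j < k \<Longrightarrow> M (j, i) = inv\<^bsub>heisenberg_group\<^esub> (M (i, j))"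
    using M unfolding H2_heisenberg_eq by blast+
  have MN: "M (i, j) = heis 0 (N i j) \<and> N i j \<in> L" if "i < k" "j < k" for i j
    using PiE_mem [OF ext, of "(i, j)"] that by (auto simp: N_def)
  have anti: "N j i = - N i j" if "i < k" "j < k" for i j
    using inv [OF that]
    unfolding MN [OF that, THEN conjunct1] MN [OF that(2,1), THEN conjunct1] by simp
  \<comment> \<open>Antisymmetry gives only \<open>2 * N i i = 0\<close>; characteristic 0 makes the
    matrix alternating.\<close>
  have diag: "N i i = 0" if "i < k" for i
  proof -
    have "2 * N i i = 0"
      unfolding mult_2 by (rule eq_neg_iff_add_eq_0 [THEN iffD1, OF anti [OF that that]])
    then show ?thesis
      by simp
  qed
  have "(gram_fibre {..<k} N :: (nat \<Rightarrow> 'f ^ ('n + 'n)) set) \<noteq> {}"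
  proof (rule alternating_realizable)
    show "card {..<k} \<le> 2 * CARD('n) + 1"
      using k by simp
    show "N j i = - N i j" if "i \<in> {..<k}" "j \<in> {..<k}" for i j
      using anti that by blast
  qed (simp_all add: diag)
  then obtain v :: "nat \<Rightarrow> 'f ^ ('n + 'n)" where "v \<in> gram_fibre {..<k} N"
    by blast
  then obtain \<rho> :: "(nat \<Rightarrow> int) \<Rightarrow> ('f, 'n) block_matrix set" where
    \<rho>: "\<rho> \<in> Hom_set k (reduced_heisenberg_group L)" "\<forall>i<k. \<forall>j<k. hom_gram k L \<rho> i j = N i j"
    using exists_hom_of_gram [of v k N] MN by blast
  have "commutator_matrix k heisenberg_group (central_lattice L) \<rho> = M"
    unfolding commutator_matrix_eq [OF \<rho>(1)]
  proof (rule extensionalityI [of _ "{..<k} \<times> {..<k}"])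
    show "M \<in> extensional ({..<k} \<times> {..<k})"
      using ext by (simp add: PiE_def)
  qed (use \<rho>(2) MN in auto)
  with \<rho>(1) show ?thesis
    by blast
qed

lemma block_matrix_entry_mem: "block_matrix_entry i j \<in> L"
  by (simp add: block_matrix_entry_def one_mem zero_mem neg_mem)

lemma block_matrix_not_in_image:
  fixes k
  defines "M \<equiv> \<lambda>(i, j)\<in>{..<k} \<times> {..<k}. heis 0 (block_matrix_entry i j)"
  assumes k: "\<not> k div 2 \<le> CARD('n::finite)"
  shows "M \<in> H2_heisenberg TYPE('n) k L"
    and "\<rho> \<in> Hom_set k (reduced_heisenberg_group L :: ('f, 'n) block_matrix set monoid) \<Longrightarrow>
      commutator_matrix k heisenberg_group (central_lattice L) \<rho> \<noteq> M"
proof -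
  show "M \<in> H2_heisenberg TYPE('n) k L"
    unfolding M_def by (intro H2_heisenbergI block_matrix_entry_mem block_matrix_entry_antisym)
  assume \<rho>: "\<rho> \<in> Hom_set k (reduced_heisenberg_group L :: ('f, 'n) block_matrix set monoid)"
  show "commutator_matrix k heisenberg_group (central_lattice L) \<rho> \<noteq> M"
  proof
    assume eq: "commutator_matrix k heisenberg_group (central_lattice L) \<rho> = M"
    have "hom_gram k L \<rho> i j = block_matrix_entry i j" if "i < k" "j < k" for i j
      using fun_cong [OF eq, of "(i, j)"] that
      unfolding commutator_matrix_eq [OF \<rho>] M_def by simp
    then have "(\<lambda>i. coset_vector L (\<rho> (unit_tuple k i))) \<in> gram_fibre {..<k} block_matrix_entry"
      by (simp add: gram_fibre_def hom_gram_def)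
    with block_matrix_not_realizable [OF k, where 'f = 'f] show False
      by blast
  qed
qed

theorem forget_flat_pi0_Rep:
  shows "forget_flat_heisenberg TYPE('n::finite) k L \<in> pi0_Rep TYPE('n) k L \<rightarrow> H2_heisenberg TYPE('n) k L"
    and "inj_on (forget_flat_heisenberg TYPE('n) k L) (pi0_Rep TYPE('n) k L)"
    and "forget_flat_heisenberg TYPE('n) k L ` pi0_Rep TYPE('n) k L = H2_heisenberg TYPE('n) k L
      \<longleftrightarrow> k div 2 \<le> CARD('n)"
proof -
  let ?Hom = "Hom_set k (reduced_heisenberg_group L :: ('f, 'n) block_matrix set monoid)"
  let ?c = "commutator_matrix k heisenberg_group (central_lattice L) ::
    _ \<Rightarrow> nat \<times> nat \<Rightarrow> ('f, 'n) block_matrix"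
  \<comment> \<open>Every component is represented by a homomorphism, so the image of the forgetful
    map is the set of commutator matrices and the rest is a statement about those.\<close>
  have image: "forget_flat_heisenberg TYPE('n) k L ` pi0_Rep TYPE('n) k L = ?c ` ?Hom"
    unfolding pi0_Rep_eq image_image by (rule image_cong [OF refl forget_flat_rep_component])
  have sub: "?c ` ?Hom \<subseteq> H2_heisenberg TYPE('n) k L"
    using commutator_matrix_mem_H2 by blast
  show "forget_flat_heisenberg TYPE('n) k L \<in> pi0_Rep TYPE('n) k L \<rightarrow> H2_heisenberg TYPE('n) k L"
    using image sub by blast
  show "inj_on (forget_flat_heisenberg TYPE('n) k L) (pi0_Rep TYPE('n) k L)"
    unfolding pi0_Rep_eq
  proof (rule inj_onI, elim imageE, simp only: forget_flat_rep_component)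
    fix \<rho> \<rho>' :: "(nat \<Rightarrow> int) \<Rightarrow> ('f, 'n) block_matrix set"
    assume "?c \<rho> = ?c \<rho>'" "\<rho> \<in> ?Hom" "\<rho>' \<in> ?Hom"
    then show "rep_component k \<rho> = rep_component k \<rho>'"
      by (intro rep_component_eq)
  qed
  show "forget_flat_heisenberg TYPE('n) k L ` pi0_Rep TYPE('n) k L = H2_heisenberg TYPE('n) k L
      \<longleftrightarrow> k div 2 \<le> CARD('n)"
    unfolding image
  proof
    assume eq: "?c ` ?Hom = H2_heisenberg TYPE('n) k L"
    show "k div 2 \<le> CARD('n)"
    proof (rule ccontr)
      assume "\<not> k div 2 \<le> CARD('n)"
      from block_matrix_not_in_image [OF this] eq show False
        by (metis (no_types, lifting) imageE)
    qed
  next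
    assume k: "k div 2 \<le> CARD('n)"
    show "?c ` ?Hom = H2_heisenberg TYPE('n) k L"
      using sub H2_realizable [OF k] by (intro equalityI subsetI) (blast, metis imageI)
  qed
qed

end

lemma additive_lattice_Ints: "additive_lattice (\<int> :: real set)"
proof
  show "countable (\<int> :: real set)"
    unfolding Ints_def by simp
qed auto

lemma additive_lattice_gaussian_integers: "additive_lattice gaussian_integers"
proof
  have "gaussian_integers \<subseteq> (\<lambda>(x, y). Complex x y) ` (\<int> \<times> \<int>)"
    by (auto simp: gaussian_integers_def image_iff complex_eq_iff)
  moreover have "countable (\<int> :: real set)"
    by (rule additive_lattice.countable [OF additive_lattice_Ints])
  ultimately show "countable gaussian_integers"
    by (meson countable_SIGMA countable_image countable_subset)
qed (auto simp: gaussian_integers_def)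

theorem corollary5:
  fixes k :: nat
  assumes "k \<ge> 2"
  shows "(forget_flat_heisenberg TYPE('n::finite) k (\<int> :: real set) \<in> pi0_Rep TYPE('n) k \<int> \<rightarrow> H2_heisenberg TYPE('n) k \<int>
        \<and> inj_on (forget_flat_heisenberg TYPE('n) k (\<int> :: real set)) (pi0_Rep TYPE('n) k \<int>)
        \<and> (forget_flat_heisenberg TYPE('n) k (\<int> :: real set) ` pi0_Rep TYPE('n) k \<int> = H2_heisenberg TYPE('n) k \<int>
             \<longleftrightarrow> k div 2 \<le> CARD('n)))
       \<and> (forget_flat_heisenberg TYPE('n) k gaussian_integers \<in> pi0_Rep TYPE('n) k gaussian_integers \<rightarrow> H2_heisenberg TYPE('n) k gaussian_integers
        \<and> inj_on (forget_flat_heisenberg TYPE('n) k gaussian_integers) (pi0_Rep TYPE('n) k gaussian_integers)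
        \<and> (forget_flat_heisenberg TYPE('n) k gaussian_integers ` pi0_Rep TYPE('n) k gaussian_integers = H2_heisenberg TYPE('n) k gaussian_integers
             \<longleftrightarrow> k div 2 \<le> CARD('n)))"
  using additive_lattice.forget_flat_pi0_Rep [OF additive_lattice_Ints, where 'n = 'n and k = k]
    additive_lattice.forget_flat_pi0_Rep [OF additive_lattice_gaussian_integers, where 'n = 'n and k = k]
  by (intro conjI)

end
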